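(* Let $k\in\mathbb{N}$ and $N\in\mathbb{N}^{\ast}$ with $N\geq 2$. Then no maximal ideal of the ring $\mathcal{R}^{k}(\mathbb{R}^{N})$ of $k$-regulous functions on $\mathbb{R}^N$ is finitely generated.
   Context: $\mathbb{N}=\{0,1,2,\dots\}$ and $\mathbb{N}^{\ast}=\{1,2,\dots\}$. A function $f:\mathbb{R}^N\to\mathbb{R}$ is called $k$-regulous if it is of class $\mathcal{C}^k$ on $\mathbb{R}^N$ and is rational, i.e. there are polynomials $p,q\in\mathbb{R}[x_1,\dots,x_N]$ with $q\not\equiv 0$ such that $f=p/q$ on a nonempty Zariski open subset of $\mathbb{R}^N$ on which $q$ does not vanish. $\mathcal{R}^k(\mathbb{R}^N)$ is the (commutative, unital) ring of $k$-regulous functions on $\mathbb{R}^N$ with pointwise operations. *)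

theory Defs
  imports "HOL-Analysis.Analysis" "HOL-Algebra.Ideal"
begin

text \<open>The derivative in direction \<open>axis i 1\<close> is the i-th partial derivative. It is only used under
  the assumption that f is differentiable, so \<^const>\<open>frechet_derivative\<close> is never arbitrary.\<close>

primrec class_C :: "nat \<Rightarrow> (real ^ 'n \<Rightarrow> real) \<Rightarrow> bool" where
  "class_C 0 f \<longleftrightarrow> continuous_on UNIV f"
| "class_C (Suc k) f \<longleftrightarrow>
     (\<forall>x. f differentiable (at x)) \<and>
     (\<forall>i. class_C k (\<lambda>x. frechet_derivative f (at x) (axis i 1)))"

text \<open>Since the real field is infinite, polynomials in N variables are identified with the
  polynomial functions they induce.\<close>

definition zariski_open :: "(real ^ 'n) set \<Rightarrow> bool" where
  "zariski_open U \<longleftrightarrow>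
     (\<exists>P. (\<forall>p\<in>P. real_polynomial_function p) \<and> U = - {x. \<forall>p\<in>P. p x = 0})"

definition rational_function :: "(real ^ 'n \<Rightarrow> real) \<Rightarrow> bool" where
  "rational_function f \<longleftrightarrow>
     (\<exists>p q U. real_polynomial_function p \<and> real_polynomial_function q \<and> q \<noteq> (\<lambda>x. 0) \<and>
        zariski_open U \<and> U \<noteq> {} \<and> (\<forall>x\<in>U. q x \<noteq> 0 \<and> f x = p x / q x))"

definition regulous :: "nat \<Rightarrow> (real ^ 'n \<Rightarrow> real) \<Rightarrow> bool" where
  "regulous k f \<longleftrightarrow> class_C k f \<and> rational_function f"

definition regulous_ring :: "nat \<Rightarrow> (real ^ 'n \<Rightarrow> real) ring" where
  "regulous_ring k =
     \<lparr>carrier = {f. regulous k f},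
      mult = (\<lambda>f g x. f x * g x), one = (\<lambda>x. 1),
      zero = (\<lambda>x. 0), add = (\<lambda>f g x. f x + g x)\<rparr>"

lemma class_C_const: "class_C k (\<lambda>x. c)"
  by (induction k arbitrary: c) auto

lemma class_C_Suc_imp: "class_C (Suc k) f \<Longrightarrow> class_C k f"
proof (induction k arbitrary: f)
  case 0
  then show ?case
    by (auto intro!: differentiable_imp_continuous_on simp: differentiable_on_def)
next
  case (Suc k)
  have "class_C k (\<lambda>x. frechet_derivative f (at x) (axis i 1))" for i
    using Suc.prems by (intro Suc.IH) simp
  then show ?case using Suc.prems by simp
qed

lemma class_C_add: "class_C k f \<Longrightarrow> class_C k g \<Longrightarrow> class_C k (\<lambda>x. f x + g x)"
proof (induction k arbitrary: f g)
  case 0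
  then show ?case by (simp add: continuous_on_add)
next
  case (Suc k)
  have "frechet_derivative (\<lambda>x. f x + g x) (at x) =
      (\<lambda>h. frechet_derivative f (at x) h + frechet_derivative g (at x) h)" for x
    using Suc.prems
    by (intro frechet_derivative_at[symmetric] has_derivative_add)
       (auto simp flip: frechet_derivative_works)
  then show ?case using Suc by simp
qed

lemma class_C_mult: "class_C k f \<Longrightarrow> class_C k g \<Longrightarrow> class_C k (\<lambda>x. f x * g x)"
proof (induction k arbitrary: f g)
  case 0
  then show ?case by (simp add: continuous_on_mult)
next
  case (Suc k)
  have "frechet_derivative (\<lambda>x. f x * g x) (at x) =
      (\<lambda>h. f x * frechet_derivative g (at x) h + frechet_derivative f (at x) h * g x)" for x
    using Suc.prems
    by (intro frechet_derivative_at[symmetric] has_derivative_mult)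
       (auto simp flip: frechet_derivative_works)
  moreover have "class_C k f" "class_C k g"
    using Suc.prems class_C_Suc_imp by blast+
  ultimately show ?case using Suc by (simp add: class_C_add)
qed

lemma polynomial_function_mult_nonzero:
  fixes p q :: "real ^ 'n \<Rightarrow> real"
  assumes p: "real_polynomial_function p" and q: "real_polynomial_function q"
    and "p a \<noteq> 0" "q b \<noteq> 0"
  shows "\<exists>x. p x * q x \<noteq> 0"
proof -
  define l where "l = (\<lambda>t::real. a + t *\<^sub>R (b - a))"
  have l: "polynomial_function l"
    unfolding l_def by (intro polynomial_function_add polynomial_function_const
      polynomial_function_bounded_linear bounded_linear_scaleR_left)
  have fin: "finite {t. r (l t) = 0}" if r: "real_polynomial_function r" "r (l s) \<noteq> 0" for r s
  proof -
    have "real_polynomial_function (r \<circ> l)"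
      using l r(1) by (rule real_polynomial_function_compose)
    then obtain c n where cn: "r \<circ> l = (\<lambda>t. \<Sum>i\<le>n. c i * t ^ i)"
      using real_polynomial_function_iff_sum by blast
    then have *: "r (l t) = (\<Sum>i\<le>n. c i * t ^ i)" for t
      by (metis comp_apply)
    have "\<exists>i\<le>n. c i \<noteq> 0"
      using r(2) by (force simp: * intro: sum.neutral)
    then show ?thesis
      unfolding * using polyfun_finite_roots[of c n] by blast
  qed
  have "finite ({t. p (l t) = 0} \<union> {t. q (l t) = 0})"
    using fin[OF p, of 0] fin[OF q, of 1] assms(3,4) by (simp add: l_def)
  then obtain t where "t \<notin> {t. p (l t) = 0} \<union> {t. q (l t) = 0}"
    using ex_new_if_finite infinite_UNIV_char_0 by blast
  then show ?thesis by auto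
qed

lemma zariski_open_Int:
  assumes "zariski_open U" "U \<noteq> {}" "zariski_open V" "V \<noteq> {}"
  shows "zariski_open (U \<inter> V)" "U \<inter> V \<noteq> {}"
proof -
  obtain P where P: "\<forall>p\<in>P. real_polynomial_function p" "U = - {x. \<forall>p\<in>P. p x = 0}"
    using assms(1) by (auto simp only: zariski_open_def)
  obtain Q where Q: "\<forall>q\<in>Q. real_polynomial_function q" "V = - {x. \<forall>q\<in>Q. q x = 0}"
    using assms(3) by (auto simp only: zariski_open_def)
  have "U \<inter> V = - {x. \<forall>r \<in> (\<lambda>(p, q) x. p x * q x) ` (P \<times> Q). r x = 0}"
    unfolding P(2) Q(2) by auto
  moreover have "\<forall>r \<in> (\<lambda>(p, q) x. p x * q x) ` (P \<times> Q). real_polynomial_function r"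
    using P(1) Q(1) by auto
  ultimately show "zariski_open (U \<inter> V)"
    unfolding zariski_open_def by blast
  obtain p a q b where "p \<in> P" "p a \<noteq> 0" "q \<in> Q" "q b \<noteq> 0"
    using assms P(2) Q(2) by blast
  moreover from this obtain x where "p x * q x \<noteq> 0"
    using polynomial_function_mult_nonzero[of p q a b] P(1) Q(1) by blast
  ultimately have "x \<in> U" "x \<in> V"
    unfolding P(2) Q(2) by auto
  then show "U \<inter> V \<noteq> {}" by blast
qed

lemma rational_function_const: "rational_function (\<lambda>x. c)"
proof -
  have "zariski_open (UNIV :: (real ^ 'n) set)"
    unfolding zariski_open_def by (rule exI[of _ "{\<lambda>x. 1}"]) auto
  then show ?thesis
    unfolding rational_function_def
    by (intro exI[of _ "\<lambda>x. c"] exI[of _ "\<lambda>x. 1"] exI[of _ UNIV]) (auto simp: fun_eq_iff)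
qed

lemma
  assumes "rational_function f" "rational_function g"
  shows rational_function_add: "rational_function (\<lambda>x. f x + g x)"
    and rational_function_mult: "rational_function (\<lambda>x. f x * g x)"
proof -
  from assms obtain p q U p' q' V where
    1: "real_polynomial_function p" "real_polynomial_function q" "zariski_open U" "U \<noteq> {}"
       "\<forall>x\<in>U. q x \<noteq> 0 \<and> f x = p x / q x" and
    2: "real_polynomial_function p'" "real_polynomial_function q'" "zariski_open V" "V \<noteq> {}"
       "\<forall>x\<in>V. q' x \<noteq> 0 \<and> g x = p' x / q' x"
    unfolding rational_function_def by metis
  have W: "zariski_open (U \<inter> V)" "U \<inter> V \<noteq> {}"
    using zariski_open_Int 1 2 by blast+
  have nz: "(\<lambda>x. q x * q' x) \<noteq> (\<lambda>x. 0)"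
    using W(2) 1(5) 2(5) by (auto simp: fun_eq_iff)
  show "rational_function (\<lambda>x. f x + g x)"
    unfolding rational_function_def
    by (rule exI[of _ "\<lambda>x. p x * q' x + p' x * q x"], rule exI[of _ "\<lambda>x. q x * q' x"],
        rule exI[of _ "U \<inter> V"])
       (use 1 2 W nz in \<open>auto simp: add_frac_eq\<close>)
  show "rational_function (\<lambda>x. f x * g x)"
    unfolding rational_function_def
    by (rule exI[of _ "\<lambda>x. p x * p' x"], rule exI[of _ "\<lambda>x. q x * q' x"],
        rule exI[of _ "U \<inter> V"])
       (use 1 2 W nz in auto)
qed

lemma regulous_const: "regulous k (\<lambda>x. c)"
  by (simp add: regulous_def class_C_const rational_function_const)

lemma regulous_add: "regulous k f \<Longrightarrow> regulous k g \<Longrightarrow> regulous k (\<lambda>x. f x + g x)"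
  by (simp add: regulous_def class_C_add rational_function_add)

lemma regulous_mult: "regulous k f \<Longrightarrow> regulous k g \<Longrightarrow> regulous k (\<lambda>x. f x * g x)"
  by (simp add: regulous_def class_C_mult rational_function_mult)

lemma cring_regulous_ring: "cring (regulous_ring k :: (real ^ 'n \<Rightarrow> real) ring)"
proof (rule cringI)
  show "abelian_group (regulous_ring k :: (real ^ 'n \<Rightarrow> real) ring)"
  proof (rule abelian_groupI)
    fix f :: "real ^ 'n \<Rightarrow> real"
    assume "f \<in> carrier (regulous_ring k)"
    then have "(\<lambda>x. - 1 * f x) \<in> carrier (regulous_ring k)"
      using regulous_mult[OF regulous_const[of k "-1"], of f] by (simp add: regulous_ring_def)
    moreover have "(\<lambda>x. - 1 * f x) \<oplus>\<^bsub>regulous_ring k\<^esub> f = \<zero>\<^bsub>regulous_ring k\<^esub>"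
      by (simp add: regulous_ring_def)
    ultimately show "\<exists>g\<in>carrier (regulous_ring k). g \<oplus>\<^bsub>regulous_ring k\<^esub> f = \<zero>\<^bsub>regulous_ring k\<^esub>"
      by blast
  qed (simp_all add: regulous_ring_def regulous_const regulous_add algebra_simps)
  show "comm_monoid (regulous_ring k :: (real ^ 'n \<Rightarrow> real) ring)"
    by (rule comm_monoidI)
       (simp_all add: regulous_ring_def regulous_const regulous_mult algebra_simps)
qed (simp add: regulous_ring_def algebra_simps)

end

theory Submission
  imports Defs
begin

text \<open>If M is generated by a finite set A, the sum of the squares of the generators lies in M and
  hence vanishes at some point a, so M is the ideal of all functions vanishing at a.  With
  local coordinates X, Y at a, consider the functions
  \<open>g\<^sub>j = X\<^bsup>2j+1\<^esup> Y\<^bsup>k+1\<^esup> / (X\<^bsup>2j+2\<^esup> + Y\<^bsup>2j\<^esup>)\<close>, which are quasi-homogeneous of degree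
  \<open>k(j+1)+1\<close> for the weights j of X and \<open>j+1\<close> of Y.  Linear algebra modulo M gives a nontrivial
  combination G of finitely many of them that is a sum of products of two elements of M.  Let J be
  the largest index in G.  On the curve \<open>X = x t\<^bsup>J\<^esup>, Y = y t\<^bsup>J+1\<^esup>\<close>, G has order
  \<open>k(J+1)+1\<close>.  But G has order at least \<open>k(J+1)+2\<close> on this curve: for k = 0 because the two factors
  of each product restrict to continuous rational functions of t vanishing at 0, and for k > 0
  because the k-th Y-derivative of a product of two elements of M is Lipschitz at a, while the
  Y-derivatives of G of order at most k vanish on Y = 0.\<close>

subsection \<open>Partial derivatives\<close>

definition partial :: "'n \<Rightarrow> (real ^ 'n \<Rightarrow> real) \<Rightarrow> real ^ 'n \<Rightarrow> real" where
  "partial i f = (\<lambda>x. frechet_derivative f (at x) (axis i 1))"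

lemma partial_eqI: "(\<And>x. (f has_derivative f' x) (at x)) \<Longrightarrow> partial i f = (\<lambda>x. f' x (axis i 1))"
  unfolding partial_def by (intro ext) (metis frechet_derivative_at)

text \<open>The recursion in terms of \<open>partial\<close>, so that higher derivatives become
  iterates \<open>partial i ^^ n\<close>; it takes the place of the original simp rule.\<close>

lemma class_C_Suc:
  "class_C (Suc k) f \<longleftrightarrow> (\<forall>x. f differentiable (at x)) \<and> (\<forall>i. class_C k (partial i f))"
  by (simp add: partial_def)

declare class_C.simps(2) [simp del]

lemma class_C_le: "class_C n f \<Longrightarrow> m \<le> n \<Longrightarrow> class_C m f"
  by (induction n) (auto simp: le_Suc_eq dest: class_C_Suc_imp)

lemma class_C_has_derivative:
  "class_C (Suc k) f \<Longrightarrow> (f has_derivative frechet_derivative f (at x)) (at x)"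
  by (simp add: class_C_Suc flip: frechet_derivative_works)

lemma class_C_funpow_partial: "class_C (m + n) f \<Longrightarrow> class_C m ((partial i ^^ n) f)"
  by (induction n arbitrary: f) (auto simp: class_C_Suc funpow_swap1)

lemma partial_mult:
  assumes "class_C (Suc m) f" "class_C (Suc n) g"
  shows "partial i (\<lambda>x. f x * g x) = (\<lambda>x. partial i f x * g x + f x * partial i g x)"
  using partial_eqI[OF has_derivative_mult[OF class_C_has_derivative[OF assms(1)]
        class_C_has_derivative[OF assms(2)]]]
  by (simp add: partial_def add.commute)

lemma partial_sum:
  assumes "\<And>j. j \<in> I \<Longrightarrow> class_C (Suc n) (f j)"
  shows "partial i (\<lambda>x. \<Sum>j\<in>I. c j * f j x) = (\<lambda>x. \<Sum>j\<in>I. c j * partial i (f j) x)"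
proof -
  have "((\<lambda>x. \<Sum>j\<in>I. c j * f j x) has_derivative
      (\<lambda>h. \<Sum>j\<in>I. c j * frechet_derivative (f j) (at x) h)) (at x)" for x
    by (intro has_derivative_sum has_derivative_mult_right class_C_has_derivative[of n] assms)
  from partial_eqI[OF this] show ?thesis
    by (simp add: partial_def)
qed

lemma class_C_sum:
  "(\<And>j. j \<in> I \<Longrightarrow> class_C k (f j)) \<Longrightarrow> class_C k (\<lambda>x. \<Sum>j\<in>I. f j x)"
  by (induction I rule: infinite_finite_induct) (auto simp: class_C_const intro: class_C_add)

lemma funpow_partial_sum:
  assumes "\<And>j. j \<in> I \<Longrightarrow> class_C n (f j)"
  shows "(partial i ^^ n) (\<lambda>x. \<Sum>j\<in>I. c j * f j x) = (\<lambda>x. \<Sum>j\<in>I. c j * (partial i ^^ n) (f j) x)"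
  using assms
proof (induction n arbitrary: f)
  case (Suc n)
  have "class_C n (partial i (f j))" if "j \<in> I" for j
    using Suc.prems[OF that] by (simp add: class_C_Suc)
  from Suc.IH[OF this] show ?case
    by (simp add: funpow_Suc_right partial_sum[where n = n, OF Suc.prems] del: funpow.simps)
qed simp

text \<open>Each partial derivative of 1/f is -(1/f) D f (1/f), a product of functions of class C^k
  by the induction hypothesis.\<close>

lemma class_C_inverse:
  assumes "class_C k f" "\<And>x. f x \<noteq> 0"
  shows "class_C k (\<lambda>x. inverse (f x))"
  using assms(1)
proof (induction k)
  case 0
  then show ?case using assms(2) by (simp add: continuous_on_inverse)
next
  case (Suc k)
  have inv: "class_C k (\<lambda>x. inverse (f x))"
    using Suc class_C_Suc_imp by blast
  have d: "((\<lambda>x. inverse (f x)) has_derivative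
      (\<lambda>h. - (inverse (f x) * frechet_derivative f (at x) h * inverse (f x)))) (at x)" for x
    by (rule Deriv.has_derivative_inverse[OF assms(2) class_C_has_derivative[OF Suc.prems]])
  have "class_C k (\<lambda>x. - 1 * (inverse (f x) * partial i f x * inverse (f x)))" for i
    by (intro class_C_mult class_C_const inv) (use Suc.prems in \<open>simp add: class_C_Suc\<close>)
  then show ?case
    using d partial_eqI[OF d] by (auto simp: class_C_Suc differentiable_def partial_def)
qed

text \<open>The fraction p/q can be inverted on the same open set U, as p has no zero on U when f
  has none.\<close>

lemma regulous_inverse:
  assumes "regulous k f" "\<And>x. f x \<noteq> 0"
  shows "regulous k (\<lambda>x. inverse (f x))"
proof -
  obtain p q U where pq: "real_polynomial_function p" "real_polynomial_function q"
    "zariski_open U" "U \<noteq> {}" "\<forall>x\<in>U. q x \<noteq> 0 \<and> f x = p x / q x"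
    using assms(1) unfolding regulous_def rational_function_def by blast
  then have "\<forall>x\<in>U. p x \<noteq> 0 \<and> inverse (f x) = q x / p x"
    using assms(2) by (metis divide_eq_0_iff inverse_divide)
  moreover from this have "p \<noteq> (\<lambda>x. 0)"
    using pq(4) by auto
  ultimately have "rational_function (\<lambda>x. inverse (f x))"
    unfolding rational_function_def using pq by blast
  then show ?thesis
    using assms class_C_inverse by (auto simp: regulous_def)
qed

lemma regulous_sum:
  "(\<And>j. j \<in> I \<Longrightarrow> regulous k (f j)) \<Longrightarrow> regulous k (\<lambda>x. \<Sum>j\<in>I. f j x)"
  by (induction I rule: infinite_finite_induct) (auto simp: regulous_const intro: regulous_add)

subsection \<open>Derivatives of products of functions vanishing at a point\<close>

text \<open>Only increments from the centre a are bounded, so differentiability at the single point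
  a suffices for it.\<close>

definition lipschitz_at :: "real ^ 'n \<Rightarrow> (real ^ 'n \<Rightarrow> real) \<Rightarrow> bool" where
  "lipschitz_at a f \<longleftrightarrow> (\<exists>C\<ge>0. \<forall>\<^sub>F x in nhds a. \<bar>f x - f a\<bar> \<le> C * norm (x - a))"

lemma lipschitz_at_differentiable:
  assumes "f differentiable (at a)"
  shows "lipschitz_at a f"
proof -
  obtain f' where f': "(f has_derivative f') (at a)"
    using assms by (auto simp: differentiable_def)
  then have bl: "bounded_linear f'"
    by (rule has_derivative_bounded_linear)
  obtain K where K: "K > 0" "\<And>h. norm (f' h) \<le> norm h * K"
    using bounded_linear.pos_bounded[OF bl] by blast
  obtain d where d: "d > 0" "\<And>y. norm (y - a) < d \<Longrightarrow> norm (f y - f a - f' (y - a)) \<le> 1 * norm (y - a)"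
    using f' unfolding has_derivative_at_alt by (meson zero_less_one)
  have "\<bar>f y - f a\<bar> \<le> (K + 1) * norm (y - a)" if "dist y a < d" for y
    using d(2)[of y] K(2)[of "y - a"] that by (simp add: dist_norm algebra_simps)
  then show ?thesis
    unfolding lipschitz_at_def eventually_nhds_metric using d(1) K(1)
    by (intro exI[of _ "K + 1"]) auto
qed

lemma lipschitz_at_add:
  assumes "lipschitz_at a f" "lipschitz_at a g"
  shows "lipschitz_at a (\<lambda>x. f x + g x)"
proof -
  obtain C D where CD: "C \<ge> 0" "D \<ge> 0" "\<forall>\<^sub>F x in nhds a. \<bar>f x - f a\<bar> \<le> C * norm (x - a)"
    "\<forall>\<^sub>F x in nhds a. \<bar>g x - g a\<bar> \<le> D * norm (x - a)"
    using assms unfolding lipschitz_at_def by blast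
  have "\<forall>\<^sub>F x in nhds a. \<bar>f x + g x - (f a + g a)\<bar> \<le> (C + D) * norm (x - a)"
    using CD(3,4) by eventually_elim (simp add: algebra_simps)
  then show ?thesis
    unfolding lipschitz_at_def using CD by (intro exI[of _ "C + D"]) auto
qed

lemma lipschitz_at_const: "lipschitz_at a (\<lambda>x. c)"
  by (simp add: lipschitz_at_differentiable)

lemma lipschitz_at_sum:
  "(\<And>j. j \<in> I \<Longrightarrow> lipschitz_at a (f j)) \<Longrightarrow> lipschitz_at a (\<lambda>x. \<Sum>j\<in>I. f j x)"
  by (induction I rule: infinite_finite_induct) (auto simp: lipschitz_at_const intro: lipschitz_at_add)

text \<open>As \<open>h a = 0\<close>, h is O(|x - a|), so u need only be bounded near a; continuity
  at a provides the bound |u a| + 1.\<close>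

lemma lipschitz_at_mult:
  assumes "isCont u a" "lipschitz_at a h" "h a = 0"
  shows "lipschitz_at a (\<lambda>x. u x * h x)"
proof -
  obtain C where C: "C \<ge> 0" "\<forall>\<^sub>F x in nhds a. \<bar>h x\<bar> \<le> C * norm (x - a)"
    using assms unfolding lipschitz_at_def by auto
  have "\<forall>\<^sub>F x in nhds a. dist (u x) (u a) < 1"
    using assms(1) by (intro tendstoD) (auto simp: continuous_within tendsto_at_iff_tendsto_nhds)
  then have "\<forall>\<^sub>F x in nhds a. \<bar>u x * h x\<bar> \<le> ((\<bar>u a\<bar> + 1) * C) * norm (x - a)"
    using C(2)
  proof eventually_elim
    case (elim x)
    have "\<bar>u x\<bar> \<le> \<bar>u a\<bar> + 1"
      using elim(1) by (auto simp: dist_real_def)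
    then have "\<bar>u x\<bar> * \<bar>h x\<bar> \<le> (\<bar>u a\<bar> + 1) * (C * norm (x - a))"
      using elim(2) by (intro mult_mono) auto
    then show ?case by (simp add: abs_mult mult_ac)
  qed
  then show ?thesis
    unfolding lipschitz_at_def using C(1) assms(3)
    by (intro exI[of _ "(\<bar>u a\<bar> + 1) * C"]) auto
qed

lemma funpow_partial_add:
  assumes "class_C n f" "class_C n g"
  shows "(partial i ^^ n) (\<lambda>x. f x + g x) = (\<lambda>x. (partial i ^^ n) f x + (partial i ^^ n) g x)"
  using funpow_partial_sum[of UNIV n "\<lambda>b. if b then f else g" i "\<lambda>_. 1"] assms
  by (simp add: UNIV_bool add.commute)

text \<open>The product is only of class \<open>C\<^sup>n\<close> here; the gain of a Lipschitz bound at a comes from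
  \<open>h a = 0\<close>.\<close>

lemma lipschitz_at_partial_mult_aux:
  assumes "class_C n u" "class_C (Suc n) h" "h a = 0"
  shows "lipschitz_at a ((partial i ^^ n) (\<lambda>x. u x * h x))"
  using assms(1,2)
proof (induction n arbitrary: u)
  case 0
  then have "isCont u a" "h differentiable (at a)"
    by (auto simp: class_C_Suc continuous_on_eq_continuous_at)
  then show ?case
    using assms(3) by (simp add: lipschitz_at_mult lipschitz_at_differentiable)
next
  case (Suc n)
  have h: "class_C (Suc n) h" "class_C (Suc n) (partial i h)"
    using Suc.prems class_C_Suc_imp by (blast, simp add: class_C_Suc)
  have Du: "class_C n (partial i u)"
    using Suc.prems by (simp add: class_C_Suc)
  \<comment> \<open>Of the two Leibniz terms, the one differentiating h is still of class C^(n+1),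
    so its n-th derivative is differentiable; the other keeps the factor h and falls under the
    induction hypothesis.\<close>
  have uDh: "class_C (Suc n) (\<lambda>x. u x * partial i h x)"
    using Suc.prems h by (intro class_C_mult)
  have "class_C 1 ((partial i ^^ n) (\<lambda>x. u x * partial i h x))"
    using uDh by (intro class_C_funpow_partial) simp
  then have "lipschitz_at a ((partial i ^^ n) (\<lambda>x. u x * partial i h x))"
    by (intro lipschitz_at_differentiable) (simp add: class_C_Suc)
  moreover have "lipschitz_at a ((partial i ^^ n) (\<lambda>x. partial i u x * h x))"
    using Du h(1) by (rule Suc.IH)
  ultimately have "lipschitz_at a
      ((partial i ^^ n) (\<lambda>x. partial i u x * h x + u x * partial i h x))"
    using class_C_mult[OF Du class_C_Suc_imp[OF h(1)]] class_C_Suc_imp[OF uDh]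
    by (simp add: funpow_partial_add lipschitz_at_add)
  then show ?case
    using Suc.prems by (simp add: funpow_Suc_right partial_mult del: funpow.simps)
qed

text \<open>After one derivative each Leibniz term is a factor of class C^n times an
  undifferentiated factor of class C^(n+1) that vanishes at a, which is the situation of
  \<open>lipschitz_at_partial_mult_aux\<close>.\<close>

lemma lipschitz_at_partial_mult:
  assumes "class_C (Suc n) f" "class_C (Suc n) h" "f a = 0" "h a = 0"
  shows "lipschitz_at a ((partial i ^^ Suc n) (\<lambda>x. f x * h x))"
proof -
  have f: "class_C n f" "class_C n (partial i f)"
    and h: "class_C n h" "class_C n (partial i h)"
    using assms class_C_Suc_imp[OF assms(1)] class_C_Suc_imp[OF assms(2)] by (simp_all add: class_C_Suc)
  have "lipschitz_at a ((partial i ^^ n) (\<lambda>x. partial i f x * h x))"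
    using f assms by (intro lipschitz_at_partial_mult_aux)
  moreover have "lipschitz_at a ((partial i ^^ n) (\<lambda>x. partial i h x * f x))"
    using h assms by (intro lipschitz_at_partial_mult_aux)
  ultimately have "lipschitz_at a
      ((partial i ^^ n) (\<lambda>x. partial i f x * h x + f x * partial i h x))"
    using f h by (simp add: funpow_partial_add class_C_mult lipschitz_at_add mult.commute)
  then show ?thesis
    using assms by (simp add: funpow_Suc_right partial_mult del: funpow.simps)
qed

text \<open>The mean value inequality in direction i, iterated k times from the hyperplane
  \<open>x $ i = a $ i\<close>; each application gains one factor of the distance to it.\<close>

lemma abs_le_power_component:
  fixes G :: "real ^ 'n \<Rightarrow> real"
  assumes "class_C k G" "B \<ge> 0"
    and "\<And>m x. m < k \<Longrightarrow> x $ i = a $ i \<Longrightarrow> (partial i ^^ m) G x = 0"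
    and "\<And>x. norm (x - a) \<le> r \<Longrightarrow> \<bar>(partial i ^^ k) G x\<bar> \<le> B"
    and "norm (x - a) \<le> r"
  shows "\<bar>G x\<bar> \<le> B * \<bar>x $ i - a $ i\<bar> ^ k"
  using assms(1,3-5)
proof (induction k arbitrary: G x)
  case (Suc k)
  define y where "y = x $ i - a $ i"
  \<comment> \<open>The line through x in direction i, parametrized so that \<open>l 0\<close> lies
    on the hyperplane and \<open>l y\<close> is x.\<close>
  define l where "l = (\<lambda>s::real. x + (s - y) *\<^sub>R axis i 1)"
  have l_comp: "l s $ j = (if j = i then a $ i + s else x $ j)" for s j
    by (simp add: l_def y_def axis_def)
  have IH: "\<bar>partial i G x\<bar> \<le> B * \<bar>x $ i - a $ i\<bar> ^ k" if "norm (x - a) \<le> r" for x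
  proof (rule Suc.IH)
    show "class_C k (partial i G)"
      using Suc.prems(1) by (simp add: class_C_Suc)
    show "(partial i ^^ m) (partial i G) x = 0" if "m < k" "x $ i = a $ i" for m x
      using Suc.prems(2)[of "Suc m" x] that by (simp add: funpow_swap1)
    show "\<bar>(partial i ^^ k) (partial i G) x\<bar> \<le> B" if "norm (x - a) \<le> r" for x
      using Suc.prems(3)[of x] that by (simp add: funpow_swap1)
  qed (fact that)
  have deriv: "((\<lambda>s. G (l s)) has_field_derivative partial i G (l s)) (at s within S)" for s S
  proof -
    have "(l has_derivative (\<lambda>s. s *\<^sub>R axis i 1)) (at s within S)"
      unfolding l_def by (auto intro!: derivative_eq_intros simp: fun_eq_iff)
    then have "((\<lambda>s. G (l s)) has_derivative
        (\<lambda>h. frechet_derivative G (at (l s)) (h *\<^sub>R axis i 1))) (at s within S)"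
      using class_C_has_derivative[OF Suc.prems(1)]
      by (intro has_derivative_compose[where f = l and g = G])
    moreover have "frechet_derivative G (at (l s)) (h *\<^sub>R axis i 1) = partial i G (l s) * h" for h
      using class_C_has_derivative[OF Suc.prems(1), of "l s"]
      by (simp add: partial_def linear_cmul[OF has_derivative_linear])
    ultimately show ?thesis
      by (simp add: has_field_derivative_def)
  qed
  have bound: "norm (partial i G (l s)) \<le> B * \<bar>y\<bar> ^ k" if "s \<in> closed_segment 0 y" for s
  proof -
    have s: "\<bar>s\<bar> \<le> \<bar>y\<bar>"
      using that by (auto simp: closed_segment_eq_real_ivl split: if_splits)
    \<comment> \<open>Moving from x towards the hyperplane only shrinks coordinate i of the
      difference to a, so the segment stays in the ball.\<close>
    have "norm (l s - a) \<le> norm (x - a)"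
      using s by (intro norm_le_componentwise_cart) (simp add: l_comp y_def)
    then have "\<bar>partial i G (l s)\<bar> \<le> B * \<bar>s\<bar> ^ k"
      using IH[of "l s"] Suc.prems(4) by (simp add: l_comp)
    also have "\<dots> \<le> B * \<bar>y\<bar> ^ k"
      using s assms(2) by (intro mult_left_mono power_mono) auto
    finally show ?thesis by simp
  qed
  have "norm (G (l y) - G (l 0)) \<le> (B * \<bar>y\<bar> ^ k) * norm (y - 0)"
    by (rule field_differentiable_bound[of "closed_segment 0 y", OF _ deriv bound]) auto
  moreover have "G (l 0) = 0"
    using Suc.prems(2)[of 0 "l 0"] by (simp add: l_comp)
  moreover have "l y = x"
    by (simp add: l_def)
  ultimately show ?case
    by (simp add: y_def mult_ac)
qed (use assms in auto)

subsection \<open>Quasi-homogeneous functions\<close>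

text \<open>Applied below with p = j + 1 and q = j. By \<open>q \<le> p\<close>, a derivative in X,
  which costs weight q, costs no more than one in Y, which costs p.\<close>

locale cusp =
  fixes a :: "real ^ 'n" and i1 i2 :: 'n and p q :: nat
  assumes i1_neq_i2: "i1 \<noteq> i2" and q_pos: "q \<ge> 1" and q_le_p: "q \<le> p"
begin

abbreviation X :: "real ^ 'n \<Rightarrow> real" where "X x \<equiv> x $ i1 - a $ i1"
abbreviation Y :: "real ^ 'n \<Rightarrow> real" where "Y x \<equiv> x $ i2 - a $ i2"

definition S :: "real ^ 'n \<Rightarrow> real" where "S x = X x ^ (2 * p) + Y x ^ (2 * q)"

definition T :: "nat \<Rightarrow> nat \<Rightarrow> nat \<Rightarrow> real ^ 'n \<Rightarrow> real" where
  "T \<alpha> \<beta> m x = X x ^ \<alpha> * Y x ^ \<beta> / S x ^ m"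

text \<open>With weight q for X and p for Y, the denominator S has weight \<open>2pq\<close>.  The class collects the
  linear combinations of \<open>X\<^sup>\<alpha> Y\<^sup>\<beta> / S\<^sup>m\<close> of weight at least d with \<open>\<beta> \<ge> e\<close>; where S vanishes, the
  value is 0 by the convention \<open>x / 0 = 0\<close>.\<close>

inductive weighted :: "nat \<Rightarrow> nat \<Rightarrow> (real ^ 'n \<Rightarrow> real) \<Rightarrow> bool" for d e :: nat where
  T: "d + 2 * p * q * m \<le> q * \<alpha> + p * \<beta> \<Longrightarrow> e \<le> \<beta> \<Longrightarrow> weighted d e (T \<alpha> \<beta> m)"
| add: "weighted d e f \<Longrightarrow> weighted d e g \<Longrightarrow> weighted d e (\<lambda>x. f x + g x)"
| scale: "weighted d e f \<Longrightarrow> weighted d e (\<lambda>x. c * f x)"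

section \<open>Vanishing, growth and continuity of weighted functions\<close>

lemma p_pos: "p \<ge> 1"
  using q_pos q_le_p by simp

lemma S_nonneg: "S x \<ge> 0"
  by (simp add: S_def)

lemma S_eq_0_iff: "S x = 0 \<longleftrightarrow> X x = 0 \<and> Y x = 0"
  using p_pos q_pos by (simp add: S_def add_nonneg_eq_0_iff)

text \<open>Obtained as 0 times a monomial whose exponents are large enough for both bounds.\<close>

lemma weighted_zero: "weighted d e (\<lambda>x. 0)"
proof -
  have "1 * d \<le> q * d"
    using q_pos by (rule mult_le_mono1)
  then have "q * (d + e) + p * (d + e) \<ge> d + 2 * p * q * 0"
    unfolding add_mult_distrib2 by linarith
  then have "weighted d e (T (d + e) (d + e) 0)"
    by (intro T) auto
  from scale[OF this, of 0] show ?thesis by simp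
qed

lemma weighted_scale_if: "(c \<noteq> 0 \<Longrightarrow> weighted d e f) \<Longrightarrow> weighted d e (\<lambda>x. c * f x)"
  using weighted_zero by (cases "c = 0") (auto intro: scale)

text \<open>Positive weight excludes \<alpha> = \<beta> = 0, so the numerator vanishes where X = Y =
  0.\<close>

lemma T_eq_0: "S x = 0 \<Longrightarrow> d + 2 * p * q * m \<le> q * \<alpha> + p * \<beta> \<Longrightarrow> d \<ge> 1 \<Longrightarrow> T \<alpha> \<beta> m x = 0"
  by (cases "\<alpha> = 0"; cases "\<beta> = 0") (auto simp: T_def S_eq_0_iff)

lemma weighted_eq_0: "weighted d e f \<Longrightarrow> d \<ge> 1 \<Longrightarrow> S x = 0 \<Longrightarrow> f x = 0"
  by (induction rule: weighted.induct) (auto simp: T_eq_0)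

lemma weighted_eq_0_axis: "weighted d e f \<Longrightarrow> e \<ge> 1 \<Longrightarrow> Y x = 0 \<Longrightarrow> f x = 0"
  by (induction rule: weighted.induct) (auto simp: T_def)

text \<open>Since X^(2p) <= S and Y^(2q) <= S, X counts as S to the power q/(2pq) and Y as S to the
  power p/(2pq). Roots are avoided by comparing D-th powers with D = 2pq; as
  \<open>S x \<le> 1\<close>, extra weight only helps.\<close>

lemma T_le:
  assumes "d + 2 * p * q * m \<le> q * \<alpha> + p * \<beta>" "d \<ge> 1" "S x \<le> 1"
  shows "\<bar>T \<alpha> \<beta> m x\<bar> \<le> S x powr (d / (2 * p * q))"
proof (cases "S x = 0")
  case True
  then show ?thesis using T_eq_0[OF True assms(1,2)] by simp
next
  case False
  define D where "D = 2 * p * q"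
  have D: "D > 0"
    using p_pos q_pos by (simp add: D_def)
  have S: "S x > 0"
    using False S_nonneg[of x] by simp
  have X: "\<bar>X x\<bar> ^ D \<le> S x ^ q"
  proof -
    have "\<bar>X x\<bar> ^ (2 * p) \<le> S x"
      by (simp add: S_def power_mult)
    from power_mono[OF this, of q] show ?thesis
      by (simp add: D_def power_mult)
  qed
  have Y: "\<bar>Y x\<bar> ^ D \<le> S x ^ p"
  proof -
    have "\<bar>Y x\<bar> ^ (2 * q) \<le> S x"
      by (simp add: S_def power_mult)
    from power_mono[OF this, of p] show ?thesis
      by (simp add: D_def mult_ac flip: power_mult)
  qed
  have "\<bar>T \<alpha> \<beta> m x\<bar> ^ D = (\<bar>X x\<bar> ^ D) ^ \<alpha> * (\<bar>Y x\<bar> ^ D) ^ \<beta> / S x ^ (D * m)"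
    using S by (simp add: T_def abs_mult power_mult_distrib power_divide mult_ac power_abs flip: power_mult)
  also have "\<dots> \<le> (S x ^ q) ^ \<alpha> * (S x ^ p) ^ \<beta> / S x ^ (D * m)"
    using S X Y by (intro divide_right_mono mult_mono power_mono) auto
  also have "\<dots> = S x ^ (q * \<alpha> + p * \<beta>) / S x ^ (D * m)"
    by (simp add: power_add power_mult)
  also have "\<dots> \<le> S x ^ (d + D * m) / S x ^ (D * m)"
    using S assms by (intro divide_right_mono power_decreasing) (auto simp: D_def)
  also have "\<dots> = S x ^ d"
    using S by (simp add: power_add)
  also have "\<dots> = (S x powr (d / D)) ^ D"
    using S D by (simp add: powr_powr flip: powr_realpow)
  finally have "\<bar>T \<alpha> \<beta> m x\<bar> \<le> S x powr (d / D)"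
    using D by (simp add: power_mono_iff)
  then show ?thesis by (simp add: D_def)
qed

text \<open>A zero z of S agrees with a in the coordinates i1 and i2, so |X| and |Y| are bounded by
  the distance to z; within distance 1 the smaller exponent 2q dominates.\<close>

lemma S_le:
  assumes "S z = 0" "norm (x - z) \<le> 1"
  shows "S x \<le> 2 * norm (x - z) ^ (2 * q)"
proof -
  have "\<bar>X x\<bar> \<le> norm (x - z)" "\<bar>Y x\<bar> \<le> norm (x - z)"
    using assms(1) component_le_norm_cart[of "x - z" i1] component_le_norm_cart[of "x - z" i2]
    by (auto simp: S_eq_0_iff)
  then have "\<bar>X x\<bar> ^ (2 * p) \<le> norm (x - z) ^ (2 * p)" "\<bar>Y x\<bar> ^ (2 * q) \<le> norm (x - z) ^ (2 * q)"
    by (auto intro: power_mono)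
  moreover have "norm (x - z) ^ (2 * p) \<le> norm (x - z) ^ (2 * q)"
    using assms(2) q_le_p by (intro power_decreasing) auto
  ultimately show ?thesis
    by (simp add: S_def power_mult)
qed

lemma isCont_S: "isCont S x"
  unfolding S_def by (intro continuous_intros)

text \<open>Where S vanishes, continuity follows by squeezing with a positive power of S.\<close>

lemma isCont_T:
  assumes "d + 2 * p * q * m \<le> q * \<alpha> + p * \<beta>" "d \<ge> 1"
  shows "isCont (T \<alpha> \<beta> m) x"
proof (cases "S x = 0")
  case False
  then show ?thesis
    unfolding T_def using isCont_S by (intro continuous_intros) auto
next
  case True
  have S: "(S \<longlongrightarrow> 0) (at x)"
    using isCont_S[of x] True by (simp add: continuous_within)
  then have ev: "\<forall>\<^sub>F y in at x. S y < 1"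
    by (rule order_tendstoD) simp
  have "((\<lambda>y. S y powr (d / (2 * p * q))) \<longlongrightarrow> 0 powr (d / (2 * p * q))) (at x)"
    using assms(2) p_pos q_pos S_nonneg by (intro tendsto_powr2 S tendsto_const) auto
  moreover have "\<forall>\<^sub>F y in at x. norm (T \<alpha> \<beta> m y) \<le> S y powr (d / (2 * p * q))"
    using ev by eventually_elim (use T_le[OF assms] in auto)
  ultimately have "(T \<alpha> \<beta> m \<longlongrightarrow> 0) (at x)"
    by (auto intro: Lim_null_comparison)
  then show ?thesis
    using T_eq_0[OF True assms] by (simp add: continuous_within)
qed

lemma weighted_isCont: "weighted d e f \<Longrightarrow> d \<ge> 1 \<Longrightarrow> isCont f x"
  by (induction rule: weighted.induct) (auto intro!: continuous_intros isCont_T)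

text \<open>\<open>T1\<close> and \<open>T2\<close> are the quotient-rule derivatives of
  \<open>T \<alpha> \<beta> m\<close> in X and Y, written as sums of scalar multiples to fit the
  rules of \<open>weighted\<close>.\<close>

definition T1 :: "nat \<Rightarrow> nat \<Rightarrow> nat \<Rightarrow> real ^ 'n \<Rightarrow> real" where
  "T1 \<alpha> \<beta> m = (\<lambda>x. real \<alpha> * T (\<alpha> - 1) \<beta> m x + (- (2 * real p * real m)) * T (\<alpha> + (2 * p - 1)) \<beta> (Suc m) x)"

definition T2 :: "nat \<Rightarrow> nat \<Rightarrow> nat \<Rightarrow> real ^ 'n \<Rightarrow> real" where
  "T2 \<alpha> \<beta> m = (\<lambda>x. real \<beta> * T \<alpha> (\<beta> - 1) m x + (- (2 * real q * real m)) * T \<alpha> (\<beta> + (2 * q - 1)) (Suc m) x)"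

text \<open>An X-derivative lowers the weight by q only, but p is charged so that both directions
  obey the same count. The bound on the Y-exponent survives here, whereas \<open>weighted_T2\<close>
  loses one.\<close>

lemma weighted_T1:
  assumes "d + p + 2 * p * q * m \<le> q * \<alpha> + p * \<beta>" "e \<le> \<beta>"
  shows "weighted d e (T1 \<alpha> \<beta> m)"
  unfolding T1_def
proof (intro add weighted_scale_if T assms(2))
  show "d + 2 * p * q * m \<le> q * (\<alpha> - 1) + p * \<beta>" if "real \<alpha> \<noteq> 0"
    using that assms(1) q_le_p by (cases \<alpha>) auto
  have "q * (\<alpha> + (2 * p - 1)) + q = q * \<alpha> + 2 * p * q"
    using p_pos by (cases p) (auto simp: algebra_simps)
  then show "d + 2 * p * q * Suc m \<le> q * (\<alpha> + (2 * p - 1)) + p * \<beta>"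
    using assms(1) q_le_p by simp
qed

lemma weighted_T2:
  assumes "d + p + 2 * p * q * m \<le> q * \<alpha> + p * \<beta>" "e \<le> \<beta>"
  shows "weighted d (e - 1) (T2 \<alpha> \<beta> m)"
  unfolding T2_def
proof (intro add weighted_scale_if T)
  show "d + 2 * p * q * m \<le> q * \<alpha> + p * (\<beta> - 1)" if "real \<beta> \<noteq> 0"
    using that assms(1) by (cases \<beta>) auto
  have "p * (\<beta> + (2 * q - 1)) + p = p * \<beta> + 2 * p * q"
    using q_pos by (cases q) (auto simp: algebra_simps)
  then show "d + 2 * p * q * Suc m \<le> q * \<alpha> + p * (\<beta> + (2 * q - 1))"
    using assms(1) by simp
qed (use assms(2) in auto)

text \<open>Away from the zeros of S this is the quotient rule. At a zero, \<open>T1\<close> and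
  \<open>T2\<close> vanish by positive weight, and T is O(r^(1 + 1/p)) in the distance r, so its
  derivative is 0.\<close>

lemma T_has_derivative:
  assumes "d + p + 2 * p * q * m \<le> q * \<alpha> + p * \<beta>" "d \<ge> 1"
  shows "(T \<alpha> \<beta> m has_derivative (\<lambda>h. T1 \<alpha> \<beta> m x * h $ i1 + T2 \<alpha> \<beta> m x * h $ i2)) (at x)"
proof (cases "S x = 0")
  case False
  have [derivative_intros]: "((\<lambda>x. x $ i) has_derivative (\<lambda>h. h $ i)) (at x)" for i
    by (intro bounded_linear_imp_has_derivative bounded_linear_vec_nth)
  have 1: "real \<alpha> * X x ^ (\<alpha> - 1) * Y x ^ \<beta> / S x ^ m
     - 2 * p * m * X x ^ \<alpha> * X x ^ (2 * p - 1) * Y x ^ \<beta> / S x ^ Suc m = T1 \<alpha> \<beta> m x"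
    by (simp add: T1_def T_def power_add mult_ac)
  have 2: "real \<beta> * X x ^ \<alpha> * Y x ^ (\<beta> - 1) / S x ^ m
     - 2 * q * m * X x ^ \<alpha> * Y x ^ (2 * q - 1) * Y x ^ \<beta> / S x ^ Suc m = T2 \<alpha> \<beta> m x"
    by (simp add: T2_def T_def power_add mult_ac)
  have dN: "((\<lambda>x. X x ^ \<alpha> * Y x ^ \<beta>) has_derivative
      (\<lambda>h. X x ^ \<alpha> * (real \<beta> * h $ i2 * Y x ^ (\<beta> - 1)) + real \<alpha> * h $ i1 * X x ^ (\<alpha> - 1) * Y x ^ \<beta>)) (at x)"
    by (auto intro!: derivative_eq_intros)
  have dS: "(S has_derivative (\<lambda>h. real (2 * p) * h $ i1 * X x ^ (2 * p - 1)
       + real (2 * q) * h $ i2 * Y x ^ (2 * q - 1))) (at x)"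
    unfolding S_def by (auto intro!: derivative_eq_intros)
  have dSm: "((\<lambda>x. inverse (S x ^ m)) has_derivative (\<lambda>h. - (real m *
     (real (2 * p) * h $ i1 * X x ^ (2 * p - 1) + real (2 * q) * h $ i2 * Y x ^ (2 * q - 1)) / S x ^ Suc m))) (at x)"
  proof (cases m)
    case (Suc n)
    show ?thesis
      unfolding Suc power_inverse[symmetric]
      by (rule has_derivative_eq_rhs[OF has_derivative_power[OF Deriv.has_derivative_inverse[OF False dS]]])
         (use False in \<open>simp add: fun_eq_iff field_simps\<close>)
  qed simp
  have "(T \<alpha> \<beta> m has_derivative (\<lambda>h. 
    (real \<alpha> * X x ^ (\<alpha> - 1) * Y x ^ \<beta> / S x ^ m
     - 2 * p * m * X x ^ \<alpha> * X x ^ (2 * p - 1) * Y x ^ \<beta> / S x ^ Suc m) * h $ i1 +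
    (real \<beta> * X x ^ \<alpha> * Y x ^ (\<beta> - 1) / S x ^ m
     - 2 * q * m * X x ^ \<alpha> * Y x ^ (2 * q - 1) * Y x ^ \<beta> / S x ^ Suc m) * h $ i2)) (at x)"
    unfolding T_def divide_inverse
    by (rule has_derivative_eq_rhs[OF has_derivative_mult[OF dN dSm]])
       (simp add: fun_eq_iff divide_inverse algebra_simps)
  then show ?thesis
    unfolding 1 2 .
next
  case True
  have 0: "T \<alpha> \<beta> m x = 0" "T1 \<alpha> \<beta> m x = 0" "T2 \<alpha> \<beta> m x = 0"
    using T_eq_0[OF True, of "d + p"] weighted_T1[OF assms(1), of 0] weighted_T2[OF assms(1), of 0] weighted_eq_0[OF _ _ True]
      assms by auto
  \<comment> \<open>T has weight at least p + 1, hence |T| <= S^s where S <= 1; inserting S <= 2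
    r^(2q) gives the exponent 2qs = 1 + 1/p of r.\<close>
  define s where "s = (p + 1) / (2 * real p * real q)"
  have s: "s \<ge> 0" by (simp add: s_def)
  have "(T \<alpha> \<beta> m has_derivative (\<lambda>h. 0)) (at x)"
  proof (rule has_derivativeI_sandwich[where e = "1/2" and H = "\<lambda>y. 2 powr s * norm (y - x) powr (1 / p)"])
    have "((\<lambda>y. 2 powr s * norm (y - x) powr (1 / p)) \<longlongrightarrow> 2 powr s * 0 powr (1 / p)) (at x)"
      using p_pos by (intro tendsto_intros tendsto_powr2 tendsto_norm_zero LIM_zero) auto
    then show "((\<lambda>y. 2 powr s * norm (y - x) powr (1 / p)) \<longlongrightarrow> 0) (at x)"
      by simp
    fix y assume y: "y \<noteq> x" "dist y x < 1 / 2"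
    define r where "r = norm (y - x)"
    have r: "0 < r" "r < 1/2"
      using y by (auto simp: r_def dist_norm)
    have Sr: "S y \<le> 2 * r ^ (2 * q)"
      using S_le[OF True, of y] r by (simp add: r_def)
    \<comment> \<open>The radius 1/2 is chosen so that S <= 2 r <= 1, as \<open>T_le\<close>
      requires.\<close>
    have "r ^ (2 * q) \<le> r ^ 1"
      using r q_pos by (intro power_decreasing) auto
    then have "S y \<le> 1"
      using Sr r by simp
    then have "\<bar>T \<alpha> \<beta> m y\<bar> \<le> S y powr s"
      using T_le[of "p + 1" m \<alpha> \<beta> y] assms by (simp add: s_def)
    also have "\<dots> \<le> (2 * r ^ (2 * q)) powr s"
      using Sr S_nonneg s by (intro powr_mono2)
    also have "\<dots> = 2 powr s * r powr (2 * real q * s)"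
      using r by (simp add: powr_mult powr_powr flip: powr_realpow)
    also have "2 * real q * s = 1 + 1 / p"
      using p_pos q_pos by (simp add: s_def field_simps)
    also have "2 powr s * r powr (1 + 1 / p) = 2 powr s * r powr (1 / p) * r"
      using r by (simp add: powr_add)
    finally have "\<bar>T \<alpha> \<beta> m y\<bar> / r \<le> 2 powr s * r powr (1 / p)"
      using r by (simp add: divide_le_eq)
    then show "norm (T \<alpha> \<beta> m y - T \<alpha> \<beta> m x - 0) / norm (y - x) \<le> 2 powr s * norm (y - x) powr (1 / p)"
      by (simp add: 0 r_def)
  qed auto
  then show ?thesis by (simp add: 0)
qed

lemma weighted_derivatives:
  assumes "weighted (d + p) e f" "d \<ge> 1"
  shows "\<exists>f1 f2. weighted d e f1 \<and> weighted d (e - 1) f2 \<and>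
    (\<forall>x. (f has_derivative (\<lambda>h. f1 x * h $ i1 + f2 x * h $ i2)) (at x))"
  using assms(1)
proof (induction rule: weighted.induct)
  case (T m \<alpha> \<beta>)
  show ?case
  proof (intro exI conjI allI)
    show "weighted d e (T1 \<alpha> \<beta> m)" "weighted d (e - 1) (T2 \<alpha> \<beta> m)"
      by (intro weighted_T1 weighted_T2 T)+
    show "(T \<alpha> \<beta> m has_derivative (\<lambda>h. T1 \<alpha> \<beta> m x * h $ i1 + T2 \<alpha> \<beta> m x * h $ i2)) (at x)" for x
      using T(1) assms(2) by (rule T_has_derivative)
  qed
next
  case (add f g)
  then obtain f1 f2 g1 g2 where
    "weighted d e f1" "weighted d (e - 1) f2" "weighted d e g1" "weighted d (e - 1) g2" and
    D: "\<And>x. (f has_derivative (\<lambda>h. f1 x * h $ i1 + f2 x * h $ i2)) (at x)"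
    "\<And>x. (g has_derivative (\<lambda>h. g1 x * h $ i1 + g2 x * h $ i2)) (at x)"
    by blast
  then show ?case
    by (intro exI[of _ "\<lambda>x. f1 x + g1 x"] exI[of _ "\<lambda>x. f2 x + g2 x"])
       (auto intro!: weighted.add has_derivative_eq_rhs[OF has_derivative_add[OF D]] simp: algebra_simps)
next
  case (scale f c)
  then obtain f1 f2 where
    "weighted d e f1" "weighted d (e - 1) f2" and
    D: "\<And>x. (f has_derivative (\<lambda>h. f1 x * h $ i1 + f2 x * h $ i2)) (at x)"
    by blast
  then show ?case
    by (intro exI[of _ "\<lambda>x. c * f1 x"] exI[of _ "\<lambda>x. c * f2 x"])
       (auto intro!: weighted.scale has_derivative_eq_rhs[OF has_derivative_mult_right[OF D]] simp: algebra_simps)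
qed

lemma weighted_mono: "weighted d e f \<Longrightarrow> e' \<le> e \<Longrightarrow> weighted d e' f"
  by (induction rule: weighted.induct) (auto intro: weighted.intros)

lemma weighted_partial:
  assumes "weighted (d + p) e f" "d \<ge> 1"
  shows "f differentiable (at x)" "weighted d (e - 1) (partial i f)"
proof -
  obtain f1 f2 where f: "weighted d e f1" "weighted d (e - 1) f2" and
    D: "\<And>x. (f has_derivative (\<lambda>h. f1 x * h $ i1 + f2 x * h $ i2)) (at x)"
    using weighted_derivatives[OF assms] by blast
  show "f differentiable (at x)"
    using D by (auto simp: differentiable_def)
  \<comment> \<open>In directions other than i1 and i2 both coefficients are 0.\<close>
  have *: "partial i f = (\<lambda>x. (if i = i1 then 1 else 0) * f1 x + (if i = i2 then 1 else 0) * f2 x)"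
    unfolding partial_eqI[OF D] by (auto simp: axis_def fun_eq_iff)
  show "weighted d (e - 1) (partial i f)"
    unfolding * by (intro weighted.add weighted.scale f weighted_mono[OF f(1)]) simp
qed

text \<open>Each derivative costs p of the weight, and a remaining weight of at least 1 gives
  continuity.\<close>

lemma weighted_class_C: "weighted d e f \<Longrightarrow> d \<ge> 1 + k * p \<Longrightarrow> class_C k f"
proof (induction k arbitrary: f d e)
  case 0
  then show ?case
    by (simp add: continuous_at_imp_continuous_on weighted_isCont)
next
  case (Suc k)
  have "weighted (d - p + p) e f" "d - p \<ge> 1" "d - p \<ge> 1 + k * p"
    using Suc.prems by auto
  with weighted_partial[OF this(1,2)] Suc.IH show ?case
    unfolding class_C_Suc by blast
qed

text \<open>Besides the weight this tracks the Y-exponent, which drops by at most one per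
  derivative: as long as \<open>e > k\<close>, the k-th derivative still vanishes on Y = 0.\<close>

lemma weighted_funpow_partial:
  "weighted d e f \<Longrightarrow> d \<ge> 1 + k * p \<Longrightarrow> weighted (d - k * p) (e - k) ((partial i ^^ k) f)"
proof (induction k)
  case (Suc k)
  have "weighted (d - Suc k * p + p) (e - k) ((partial i ^^ k) f)"
    using Suc by simp
  from weighted_partial(2)[OF this] show ?case
    using Suc.prems by simp
qed simp

end

subsection \<open>Regulous functions on monomial curves\<close>

lemma real_polynomial_function_real_poly:
  fixes f :: "real \<Rightarrow> real"
  assumes "real_polynomial_function f"
  obtains P :: "real poly" where "f = poly P"
proof -
  obtain c n where "f = (\<lambda>x. \<Sum>i\<le>n. c i * x ^ i)"
    using assms real_polynomial_function_iff_sum by blast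
  then have "f = poly (\<Sum>i\<le>n. monom (c i) i)"
    by (simp add: fun_eq_iff poly_sum poly_monom)
  then show thesis by (rule that)
qed

lemma eventually_poly_neq_0:
  fixes P :: "real poly"
  assumes "P \<noteq> 0"
  shows "\<forall>\<^sub>F t in at x. poly P t \<noteq> 0"
proof -
  have "closed ({t. poly P t = 0} - {x})"
    using assms by (intro finite_imp_closed) (simp add: poly_roots_finite)
  then have "\<forall>\<^sub>F t in nhds x. t \<in> - ({t. poly P t = 0} - {x})"
    by (intro eventually_nhds_in_open[OF open_Compl]) auto
  then show ?thesis
    by (auto simp: eventually_at_filter elim: eventually_mono)
qed

text \<open>A rational function of one variable that tends to 0 has order at least 1. Common factors
  t are cancelled, by induction on the degree of Q, until Q(0) is nonzero.\<close>

lemma rational_vanishing_linear: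
  fixes P Q :: "real poly" and \<phi> :: "real \<Rightarrow> real"
  assumes "(\<phi> \<longlongrightarrow> 0) (at 0)" "Q \<noteq> 0" "\<forall>\<^sub>F t in at 0. \<phi> t * poly Q t = poly P t"
  shows "\<exists>C. \<forall>\<^sub>F t in at 0. \<bar>\<phi> t\<bar> \<le> C * \<bar>t\<bar>"
  using assms(2,3)
proof (induction "degree Q" arbitrary: P Q rule: less_induct)
  case less
  have lim: "(poly R \<longlongrightarrow> poly R 0) (at 0)" for R :: "real poly"
    using poly_isCont[of 0 R] by (simp add: continuous_within)
  have "((\<lambda>t. \<phi> t * poly Q t) \<longlongrightarrow> 0) (at 0)"
    using tendsto_mult[OF assms(1) lim[of Q]] by simp
  then have "(poly P \<longlongrightarrow> 0) (at 0)"
    using less.prems(2) by (auto intro: Lim_transform_eventually)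
  then have "poly P 0 = 0"
    using lim[of P] by (intro LIM_unique)
  then obtain P1 where P: "P = [:0, 1:] * P1"
    by (metis poly_eq_0_iff_dvd dvdE minus_zero)
  show ?case
  proof (cases "poly Q 0 = 0")
    case True
    then obtain Q1 where Q: "Q = [:0, 1:] * Q1"
      by (metis poly_eq_0_iff_dvd dvdE minus_zero)
    have "Q1 \<noteq> 0" "degree Q1 < degree Q"
      using Q less.prems(1) by auto
    moreover have "\<forall>\<^sub>F t in at 0. \<phi> t * poly Q1 t = poly P1 t"
      using less.prems(2) eventually_neq_at_within[of 0 0 UNIV]
      by eventually_elim (simp add: P Q)
    ultimately show ?thesis
      using less.hyps by blast
  next
    case False
    have "((\<lambda>t. \<bar>poly P1 t / poly Q t\<bar>) \<longlongrightarrow> \<bar>poly P1 0 / poly Q 0\<bar>) (at 0)"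
      using False by (intro tendsto_intros lim)
    then have "\<forall>\<^sub>F t in at 0. \<bar>poly P1 t / poly Q t\<bar> < \<bar>poly P1 0 / poly Q 0\<bar> + 1"
      by (rule order_tendstoD) simp
    then have "\<forall>\<^sub>F t in at 0. \<bar>\<phi> t\<bar> \<le> (\<bar>poly P1 0 / poly Q 0\<bar> + 1) * \<bar>t\<bar>"
      using less.prems(2) eventually_poly_neq_0[OF less.prems(1), of 0]
    proof eventually_elim
      case (elim t)
      have "\<phi> t = poly P1 t / poly Q t * t"
        using elim(2,3) by (simp add: P field_simps)
      then show ?case
        using elim(1) by (auto simp only: abs_mult intro!: mult_right_mono)
    qed
    then show ?thesis by blast
  qed
qed

text \<open>A weighted dilation about a with ratio t. As the curve passes through z at t = 1, a
  polynomial that is nonzero at z restricts to a nonzero polynomial in t.\<close>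

definition curve :: "real ^ 'n \<Rightarrow> ('n \<Rightarrow> nat) \<Rightarrow> real ^ 'n \<Rightarrow> real \<Rightarrow> real ^ 'n" where
  "curve a e z t = (\<chi> i. a $ i + t ^ e i * (z $ i - a $ i))"

lemma curve_nth [simp]: "curve a e z t $ i = a $ i + t ^ e i * (z $ i - a $ i)"
  by (simp add: curve_def)

lemma curve_1: "curve a e z 1 = z"
  by (simp add: vec_eq_iff)

lemma curve_0:
  assumes "\<And>i. e i \<ge> 1"
  shows "curve a e z 0 = a"
proof -
  have "e i \<noteq> 0" for i
    using assms[of i] by simp
  then show ?thesis
    by (simp only: vec_eq_iff curve_nth power_0_left if_False) simp
qed

lemma isCont_curve: "isCont (curve a e z) t"
  unfolding curve_def isCont_def by (intro tendsto_intros)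

lemma polynomial_function_curve: "polynomial_function (curve a e z)"
proof -
  have "real_polynomial_function (\<lambda>t. a $ i + t ^ e i * (z $ i - a $ i))" for i
    by (intro real_polynomial_function.intros(2-4) real_polynomial_function_power
        real_polynomial_function.intros(1)[OF bounded_linear_ident])
  then show ?thesis
    unfolding polynomial_function_iff_Basis_inner by (auto simp: Basis_vec_def inner_axis)
qed

text \<open>Both q and some polynomial r witnessing that z is in U restrict to nonzero polynomials
  in t. So the curve lies in U for all small nonzero t, where f is a quotient of polynomials in t,
  and \<open>rational_vanishing_linear\<close> applies.\<close>

lemma rational_function_curve:
  fixes a z :: "real ^ 'n"
  assumes "continuous_on UNIV f" "f a = 0"
    and "real_polynomial_function p" "real_polynomial_function q" "zariski_open U" "z \<in> U"
    and "\<And>x. x \<in> U \<Longrightarrow> q x \<noteq> 0 \<and> f x = p x / q x"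
    and "\<And>i. e i \<ge> 1"
  shows "\<exists>C. \<forall>\<^sub>F t in at 0. \<bar>f (curve a e z t)\<bar> \<le> C * \<bar>t\<bar>"
proof -
  have poly: "\<exists>P. \<forall>t. g (curve a e z t) = poly P t" if g: "real_polynomial_function g" for g :: "real ^ 'n \<Rightarrow> real"
  proof -
    have "real_polynomial_function (g \<circ> curve a e z)"
      using polynomial_function_curve g by (rule real_polynomial_function_compose)
    then obtain P where "g \<circ> curve a e z = poly P"
      by (rule real_polynomial_function_real_poly)
    then show ?thesis by (metis comp_apply)
  qed
  obtain V where V: "\<forall>r\<in>V. real_polynomial_function r" "U = - {x. \<forall>r\<in>V. r x = 0}"
    using assms(5) by (auto simp only: zariski_open_def)
  obtain r where r: "r \<in> V" "r z \<noteq> 0"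
    using assms(6) V(2) by auto
  obtain P Q R where PQR: "\<And>t. p (curve a e z t) = poly P t" "\<And>t. q (curve a e z t) = poly Q t"
      "\<And>t. r (curve a e z t) = poly R t"
    using poly assms(3,4) V(1) r(1) by metis
  have "R \<noteq> 0" "Q \<noteq> 0"
    using PQR(2,3)[of 1] r(2) assms(6,7) by (auto simp: curve_1)
  have "\<forall>\<^sub>F t in at 0. f (curve a e z t) * poly Q t = poly P t"
    using eventually_poly_neq_0[OF \<open>R \<noteq> 0\<close>, of 0]
  proof eventually_elim
    case (elim t)
    then have "curve a e z t \<in> U"
      using r(1) unfolding V(2) PQR(3)[symmetric] by auto
    from assms(7)[OF this] show ?case
      by (simp add: PQR)
  qed
  moreover have "((\<lambda>t. f (curve a e z t)) \<longlongrightarrow> 0) (at 0)"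
  proof -
    have "isCont f (curve a e z 0)"
      using assms(1) by (simp add: continuous_on_eq_continuous_at)
    then have "isCont (\<lambda>t. f (curve a e z t)) 0"
      by (intro isCont_o2[OF isCont_curve])
    then show ?thesis
      using assms(2,8) by (simp add: continuous_within curve_0)
  qed
  ultimately show ?thesis
    using \<open>Q \<noteq> 0\<close> by (intro rational_vanishing_linear)
qed

section \<open>Finite intersections of Zariski open sets, and homogeneous linear systems\<close>

lemma finite_zariski_open_Int:
  assumes "finite I" "\<And>i. i \<in> I \<Longrightarrow> zariski_open (U i) \<and> U i \<noteq> {}"
  shows "zariski_open (\<Inter>i\<in>I. U i) \<and> (\<Inter>i\<in>I. U i) \<noteq> ({} :: (real ^ 'n) set)"
  using assms
proof (induction I)
  case empty
  have "zariski_open (UNIV :: (real ^ 'n) set)"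
    unfolding zariski_open_def by (rule exI[of _ "{\<lambda>x. 1}"]) auto
  then show ?case by simp
next
  case (insert i I)
  then have "zariski_open (\<Inter>i\<in>I. U i) \<and> (\<Inter>i\<in>I. U i) \<noteq> {}" "zariski_open (U i) \<and> U i \<noteq> {}"
    by auto
  then show ?case
    using zariski_open_Int[of "U i" "\<Inter>i\<in>I. U i"] by simp
qed

lemma zariski_open_component_neq:
  "zariski_open {x :: real ^ 'n. x $ i \<noteq> c}" "{x :: real ^ 'n. x $ i \<noteq> c} \<noteq> {}"
proof -
  have "real_polynomial_function (\<lambda>x :: real ^ 'n. x $ i - c)"
    by (intro real_polynomial_function_diff real_polynomial_function.intros bounded_linear_vec_nth)
  then show "zariski_open {x :: real ^ 'n. x $ i \<noteq> c}"
    unfolding zariski_open_def by (intro exI[of _ "{\<lambda>x. x $ i - c}"]) auto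
  have "(\<chi> _. c + 1) \<in> {x :: real ^ 'n. x $ i \<noteq> c}" by simp
  then show "{x :: real ^ 'n. x $ i \<noteq> c} \<noteq> {}" by blast
qed

text \<open>Gaussian elimination by induction on the set A of equations; the unknowns are indexed by
  I.\<close>

lemma homogeneous_system_solution:
  fixes h :: "'b \<Rightarrow> 'a \<Rightarrow> real"
  assumes "finite A" "finite I" "card A < card I"
  shows "\<exists>c. (\<exists>j\<in>I. c j \<noteq> 0) \<and> (\<forall>a\<in>A. (\<Sum>j\<in>I. c j * h j a) = 0)"
  using assms
proof (induction A arbitrary: I h rule: finite_induct)
  case empty
  then show ?case by (intro exI[of _ "\<lambda>_. 1"]) (auto simp: card_gt_0_iff)
next
  case (insert b A)
  show ?case
  proof (cases "\<forall>j\<in>I. h j b = 0")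
    case True
    then show ?thesis
      using insert.IH[of I h] insert.prems insert.hyps by auto
  next
    case False
    then obtain k where k: "k \<in> I" "h k b \<noteq> 0" by blast
    \<comment> \<open>Unknown k is eliminated by means of equation b, on which \<open>h'\<close> is
      zero.\<close>
    define h' where "h' j a = h j a - h j b / h k b * h k a" for j a
    have "finite (I - {k})" "card A < card (I - {k})"
      using insert.prems insert.hyps k(1) by auto
    from insert.IH[OF this, of h'] obtain c j
      where c: "j \<in> I - {k}" "c j \<noteq> 0" "\<forall>a\<in>A. (\<Sum>j\<in>I - {k}. c j * h' j a) = 0"
      by blast
    define s where "s = (\<Sum>j\<in>I - {k}. c j * h j b / h k b)"
    \<comment> \<open>The value -s of unknown k is forced by equation b.\<close>
    define c' where "c' = c(k := - s)"
    have eq: "(\<Sum>j\<in>I. c' j * h j a) = (\<Sum>j\<in>I - {k}. c j * h' j a)" for a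
    proof -
      have "(\<Sum>j\<in>I. c' j * h j a) = - s * h k a + (\<Sum>j\<in>I - {k}. c' j * h j a)"
        using k(1) insert.prems by (simp add: sum.remove c'_def)
      also have "(\<Sum>j\<in>I - {k}. c' j * h j a) = (\<Sum>j\<in>I - {k}. c j * h j a)"
        by (intro sum.cong) (auto simp: c'_def)
      finally show ?thesis
        by (simp add: h'_def s_def sum_subtractf sum_distrib_left algebra_simps)
    qed
    have "(\<Sum>j\<in>I. c' j * h j b) = 0"
      unfolding eq h'_def using k(2) by simp
    then have "\<forall>a\<in>insert b A. (\<Sum>j\<in>I. c' j * h j a) = 0"
      using c(3) by (auto simp: eq)
    moreover have "c' j \<noteq> 0"
      using c(1,2) by (simp add: c'_def)
    ultimately show ?thesis
      using c(1) by blast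
  qed
qed

subsection \<open>Finitely generated ideals\<close>

text \<open>With the minimality of the generated ideal, this turns its elements into explicit finite
  combinations, in \<open>regulous_genideal\<close>.\<close>

lemma ideal_regulous_span:
  assumes "A \<subseteq> carrier (regulous_ring k)" "finite A"
  shows "ideal {f. \<exists>h. (\<forall>a\<in>A. regulous k (h a)) \<and> f = (\<lambda>x. \<Sum>a\<in>A. h a x * a x)}
    (regulous_ring k :: (real ^ 'n \<Rightarrow> real) ring)" (is "ideal ?I ?R")
proof -
  interpret cring ?R by (rule cring_regulous_ring)
  have A: "regulous k a" if "a \<in> A" for a
    using that assms(1) by (auto simp: regulous_ring_def)
  have zero: "(\<lambda>x. 0) \<in> ?I"
    by (auto intro!: exI[of _ "\<lambda>_ _. 0"] simp: regulous_const)
  have add: "(\<lambda>x. f x + g x) \<in> ?I" if "f \<in> ?I" "g \<in> ?I" for f g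
  proof -
    from that obtain h h' where "\<forall>a\<in>A. regulous k (h a)" "f = (\<lambda>x. \<Sum>a\<in>A. h a x * a x)"
      "\<forall>a\<in>A. regulous k (h' a)" "g = (\<lambda>x. \<Sum>a\<in>A. h' a x * a x)" by blast
    then show ?thesis
      by (auto intro!: exI[of _ "\<lambda>a x. h a x + h' a x"] regulous_add simp: algebra_simps sum.distrib)
  qed
  have mult: "(\<lambda>x. r x * f x) \<in> ?I" if "f \<in> ?I" "regulous k r" for f r
  proof -
    from that obtain h where "\<forall>a\<in>A. regulous k (h a)" "f = (\<lambda>x. \<Sum>a\<in>A. h a x * a x)" by blast
    then show ?thesis
      using that by (auto intro!: exI[of _ "\<lambda>a x. r x * h a x"] regulous_mult
          simp: mult.assoc sum_distrib_left)
  qed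
  have sub: "?I \<subseteq> carrier ?R"
    using A by (auto simp: regulous_ring_def intro!: regulous_sum regulous_mult)
  show ?thesis
  proof (rule idealI)
    show "ring ?R" by (rule ring_axioms)
    show "subgroup ?I (add_monoid ?R)"
    proof (rule add.subgroupI)
      show "?I \<subseteq> carrier ?R" by (rule sub)
      show "?I \<noteq> {}" using zero by blast
      show "\<ominus>\<^bsub>?R\<^esub> f \<in> ?I" if f: "f \<in> ?I" for f
      proof -
        have "(\<lambda>x. - 1 * f x) \<in> ?I"
          using f by (intro mult regulous_const)
        moreover have "\<ominus>\<^bsub>?R\<^esub> f = (\<lambda>x. - 1 * f x)"
          using f sub \<open>(\<lambda>x. - 1 * f x) \<in> ?I\<close>
          by (intro minus_equality) (auto simp: regulous_ring_def)
        ultimately show ?thesis by simp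
      qed
      show "f \<oplus>\<^bsub>?R\<^esub> g \<in> ?I" if "f \<in> ?I" "g \<in> ?I" for f g
        using add[OF that] by (simp add: regulous_ring_def)
    qed
    show "r \<otimes>\<^bsub>?R\<^esub> f \<in> ?I" if "f \<in> ?I" "r \<in> carrier ?R" for f r
      using mult[of f r] that by (simp add: regulous_ring_def)
    show "f \<otimes>\<^bsub>?R\<^esub> r \<in> ?I" if "f \<in> ?I" "r \<in> carrier ?R" for f r
      using mult[of f r] that by (simp add: regulous_ring_def mult.commute)
  qed
qed

lemma regulous_genideal:
  fixes A :: "(real ^ 'n \<Rightarrow> real) set"
  assumes "A \<subseteq> carrier (regulous_ring k)" "finite A" "f \<in> Idl\<^bsub>regulous_ring k\<^esub> A"
  shows "\<exists>h. (\<forall>a\<in>A. regulous k (h a)) \<and> f = (\<lambda>x. \<Sum>a\<in>A. h a x * a x)"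
proof -
  interpret cring "regulous_ring k :: (real ^ 'n \<Rightarrow> real) ring" by (rule cring_regulous_ring)
  let ?I = "{f. \<exists>h. (\<forall>a\<in>A. regulous k (h a)) \<and> f = (\<lambda>x. \<Sum>a\<in>A. h a x * a x)}"
  have "A \<subseteq> ?I"
  proof
    fix b assume b: "b \<in> A"
    have "b = (\<lambda>x. \<Sum>a\<in>A. (if a = b then 1 else 0) * a x)"
      using b assms(2) by (simp add: if_distrib[where f = "\<lambda>c. c * _"] cong: if_cong)
    then show "b \<in> ?I"
      by (auto intro!: exI[of _ "\<lambda>a x. if a = b then 1 else 0"] simp: regulous_const)
  qed
  then have "f \<in> ?I"
    using genideal_minimal[OF ideal_regulous_span[OF assms(1,2)]] assms(3) by blast
  then show ?thesis by simp
qed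

lemma ideal_regulous_vanishing:
  "ideal {f. regulous k f \<and> f z = 0} (regulous_ring k :: (real ^ 'n \<Rightarrow> real) ring)"
  (is "ideal ?I ?R")
proof -
  interpret cring ?R by (rule cring_regulous_ring)
  show ?thesis
  proof (rule idealI)
    show "ring ?R" by (rule ring_axioms)
    show "subgroup ?I (add_monoid ?R)"
    proof (rule add.subgroupI)
      show "\<ominus>\<^bsub>?R\<^esub> f \<in> ?I" if f: "f \<in> ?I" for f
      proof -
        have r: "regulous k (\<lambda>x. - 1 * f x)"
          using f by (intro regulous_mult regulous_const) auto
        have "\<ominus>\<^bsub>?R\<^esub> f = (\<lambda>x. - 1 * f x)"
          using f r by (intro minus_equality) (auto simp: regulous_ring_def)
        then show ?thesis using f r by simp
      qed
    qed (auto simp: regulous_ring_def regulous_add intro: exI[of _ "\<lambda>x. 0"] regulous_const)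
  qed (auto simp: regulous_ring_def regulous_mult)
qed

text \<open>If the generators had no common zero, their sum of squares would be invertible by
  \<open>regulous_inverse\<close> and M would contain 1. So M lies in the proper ideal of functions
  vanishing at a common zero, and maximality gives equality.\<close>

lemma maximalideal_finitely_generated:
  fixes M :: "(real ^ 'n \<Rightarrow> real) set"
  assumes "maximalideal M (regulous_ring k)"
    and "A \<subseteq> carrier (regulous_ring k)" "finite A" "M = Idl\<^bsub>regulous_ring k\<^esub> A"
  obtains z where "M = {f. regulous k f \<and> f z = 0}"
proof -
  let ?R = "regulous_ring k :: (real ^ 'n \<Rightarrow> real) ring"
  interpret cring ?R by (rule cring_regulous_ring)
  interpret maximalideal M ?R by (rule assms(1))
  have A: "regulous k a" if "a \<in> A" for a
    using that assms(2) by (auto simp: regulous_ring_def)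
  have AM: "A \<subseteq> M"
    using genideal_self[OF assms(2)] assms(4) by simp
  have sum_M: "(\<lambda>x. \<Sum>a\<in>B. a x * a x) \<in> M" if "B \<subseteq> A" for B
    using finite_subset[OF that assms(3)] that
  proof (induction B rule: finite_induct)
    case empty
    then show ?case using zero_closed by (simp add: regulous_ring_def)
  next
    case (insert b B)
    have "(\<lambda>x. b x * b x) \<in> M"
      using I_l_closed[of b b] insert.prems AM A[of b] by (auto simp: regulous_ring_def)
    then show ?case
      using a_closed[of "\<lambda>x. b x * b x" "\<lambda>x. \<Sum>a\<in>B. a x * a x"] insert
      by (simp add: regulous_ring_def)
  qed
  have "\<exists>z. \<forall>a\<in>A. a z = 0"
  proof (rule ccontr)
    define s where "s = (\<lambda>x. \<Sum>a\<in>A. a x * a x)"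
    assume "\<not> ?thesis"
    then have s0: "s x \<noteq> 0" for x
      unfolding s_def using assms(3) by (subst sum_nonneg_eq_0_iff) auto
    have s: "s \<in> M" "regulous k s"
      using sum_M[of A] A by (auto simp: s_def intro!: regulous_sum regulous_mult)
    have "(\<lambda>x. inverse (s x) * s x) \<in> M"
      using I_l_closed[OF s(1), of "\<lambda>x. inverse (s x)"] regulous_inverse[OF s(2) s0]
      by (simp add: regulous_ring_def)
    then have "\<one>\<^bsub>?R\<^esub> \<in> M"
      using s0 by (simp add: regulous_ring_def)
    then show False
      using one_imp_carrier I_notcarr by simp
  qed
  then obtain z where z: "\<And>a. a \<in> A \<Longrightarrow> a z = 0" by blast
  let ?I = "{f. regulous k f \<and> f z = 0}"
  have I: "ideal ?I ?R"
    by (rule ideal_regulous_vanishing)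
  have "M \<subseteq> ?I"
    unfolding assms(4) using A z by (intro genideal_minimal[OF I]) auto
  moreover have "?I \<noteq> carrier ?R"
    using regulous_const[of k "1"] by (auto simp: regulous_ring_def)
  moreover have "?I \<subseteq> carrier ?R"
    by (auto simp: regulous_ring_def)
  ultimately show thesis
    using I_maximal[OF I] that[of z] by blast
qed

subsection \<open>Cusp functions\<close>

text \<open>These are the \<open>g\<^sub>j\<close> of the proof idea, with value 0 where the
  denominator vanishes. The factor Y^(k+1) makes all Y-derivatives up to order k vanish on Y =
  0.\<close>

definition cusp_function :: "nat \<Rightarrow> real ^ 'n \<Rightarrow> 'n \<Rightarrow> 'n \<Rightarrow> nat \<Rightarrow> real ^ 'n \<Rightarrow> real" where
  "cusp_function k a i1 i2 j x = (x $ i1 - a $ i1) ^ (2 * j + 1) * (x $ i2 - a $ i2) ^ (k + 1) /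
     ((x $ i1 - a $ i1) ^ (2 * (j + 1)) + (x $ i2 - a $ i2) ^ (2 * j))"

lemma
  fixes a :: "real ^ 'n"
  assumes "i1 \<noteq> i2" "j \<ge> 1"
  shows regulous_cusp_function: "regulous k (cusp_function k a i1 i2 j)"
    and funpow_partial_cusp_function:
      "m \<le> k \<Longrightarrow> x $ i2 = a $ i2 \<Longrightarrow> (partial i2 ^^ m) (cusp_function k a i1 i2 j) x = 0"
proof -
  interpret cusp a i1 i2 "j + 1" j
    using assms by unfold_locales auto
  have g: "cusp_function k a i1 i2 j = T (2 * j + 1) (k + 1) 1"
    by (rule ext) (simp only: cusp_function_def T_def S_def power_one_right)
  \<comment> \<open>The weight is j(2j+1) + (j+1)(k+1) - 2j(j+1) = 1 + k(j+1), exactly what k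
    derivatives of cost p = j + 1 and continuity consume.\<close>
  have weighted_g: "weighted (1 + k * (j + 1)) (k + 1) (cusp_function k a i1 i2 j)"
    unfolding g by (intro weighted.T) (auto simp: algebra_simps)
  have "rational_function (cusp_function k a i1 i2 j)"
  proof -
    have "real_polynomial_function (\<lambda>x :: real ^ 'n. x $ i - a $ i)" for i
      by (intro real_polynomial_function_diff real_polynomial_function.intros bounded_linear_vec_nth)
    then have P: "real_polynomial_function (\<lambda>x. X x ^ (2 * j + 1) * Y x ^ (k + 1))"
      and S: "real_polynomial_function S"
      unfolding S_def by (intro real_polynomial_function.intros(3,4) real_polynomial_function_power; simp)+
    have open_S: "zariski_open {x. S x \<noteq> 0}"
      unfolding zariski_open_def using S by (intro exI[of _ "{S}"]) auto
    have "S (\<chi> i. a $ i + 1) \<noteq> 0"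
      unfolding S_eq_0_iff by simp
    then have "S \<noteq> (\<lambda>x. 0)" "{x. S x \<noteq> 0} \<noteq> {}"
      by auto
    show ?thesis
      unfolding rational_function_def
    proof (intro exI conjI ballI)
      show "cusp_function k a i1 i2 j x = X x ^ (2 * j + 1) * Y x ^ (k + 1) / S x" for x
        by (simp only: cusp_function_def S_def)
    qed (fact | simp)+
  qed
  then show "regulous k (cusp_function k a i1 i2 j)"
    using weighted_class_C[OF weighted_g] by (simp add: regulous_def)
  assume m: "m \<le> k" and x: "x $ i2 = a $ i2"
  have "weighted (1 + k * (j + 1) - m * (j + 1)) (k + 1 - m) ((partial i2 ^^ m) (cusp_function k a i1 i2 j))"
    using mult_le_mono1[OF m, of "j + 1"] by (intro weighted_funpow_partial[OF weighted_g]) simp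
  from weighted_eq_0_axis[OF this] m x show "(partial i2 ^^ m) (cusp_function k a i1 i2 j) x = 0"
    by simp
qed

abbreviation cusp_curve :: "real ^ 'n \<Rightarrow> 'n \<Rightarrow> nat \<Rightarrow> real ^ 'n \<Rightarrow> real \<Rightarrow> real ^ 'n" where
  "cusp_curve a i2 J z \<equiv> curve a (\<lambda>i. if i = i2 then Suc J else J) z"

text \<open>The curve carries the weights of index J: the numerator scales by t^(J(2J+1) +
  (J+1)(k+1)) and both terms of the denominator by t^(2J(J+1)).\<close>

lemma cusp_function_curve_eq:
  assumes "i1 \<noteq> i2" "z $ i1 \<noteq> a $ i1" "z $ i2 \<noteq> a $ i2" "t > 0"
  shows "cusp_function k a i1 i2 J (cusp_curve a i2 J z t) =
    cusp_function k a i1 i2 J z * t ^ (k * (J + 1) + 1)"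
proof -
  have *: "(t ^ J * w) ^ (2 * J + 1) * (t ^ Suc J * v) ^ (k + 1) / 
      ((t ^ J * w) ^ (2 * (J + 1)) + (t ^ Suc J * v) ^ (2 * J)) =
      w ^ (2 * J + 1) * v ^ (k + 1) / (w ^ (2 * (J + 1)) + v ^ (2 * J)) * t ^ (k * (J + 1) + 1)" for w v
  proof -
    have e: "J * (2 * J + 1) + Suc J * (k + 1) = 2 * J * (J + 1) + (k * (J + 1) + 1)"
      by (simp add: algebra_simps)
    have num: "(t ^ J * w) ^ (2 * J + 1) * (t ^ Suc J * v) ^ (k + 1) =
        t ^ (J * (2 * J + 1) + Suc J * (k + 1)) * (w ^ (2 * J + 1) * v ^ (k + 1))"
      unfolding power_mult_distrib power_mult[symmetric] power_add[of t] by (simp only: mult_ac)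
    have den: "(t ^ J * w) ^ (2 * (J + 1)) + (t ^ Suc J * v) ^ (2 * J) =
        t ^ (2 * J * (J + 1)) * (w ^ (2 * (J + 1)) + v ^ (2 * J))"
      unfolding power_mult_distrib power_mult[symmetric] by (simp add: algebra_simps)
    have cancel: "s * r * n / (s * d) = n / d * r" if "s \<noteq> 0" for s r n d :: real
      using that by simp
    show ?thesis
      unfolding num den e power_add[of t "2 * J * (J + 1)"] using assms(4) by (intro cancel) simp
  qed
  show ?thesis
    unfolding cusp_function_def using assms(1) * by simp
qed

text \<open>For j < J the Y-term of the denominator has the smaller order 2j(J+1), and the X-term is
  dropped. The order obtained is k(J+1) + 1 + 2(J - j), hence at least k(J+1) + 2.\<close>

lemma cusp_function_curve_le:
  assumes "i1 \<noteq> i2" "z $ i2 \<noteq> a $ i2" "j < J" "0 < t" "t \<le> 1"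
  shows "\<bar>cusp_function k a i1 i2 j (cusp_curve a i2 J z t)\<bar> \<le>
    \<bar>z $ i1 - a $ i1\<bar> ^ (2 * j + 1) * \<bar>z $ i2 - a $ i2\<bar> ^ (k + 1) / (z $ i2 - a $ i2) ^ (2 * j)
      * t ^ (k * (J + 1) + 2)"
proof -
  define w v where "w = z $ i1 - a $ i1" and "v = z $ i2 - a $ i2"
  define e where "e = 2 * j * Suc J"
  have v: "v ^ (2 * j) > 0"
    using assms(2) by (simp add: v_def power_mult)
  have "k * (J + 1) + 2 + e \<le> J * (2 * j + 1) + Suc J * (k + 1)"
    using assms(3) by (simp add: e_def algebra_simps)
  then have le: "t ^ (J * (2 * j + 1) + Suc J * (k + 1)) \<le> t ^ (k * (J + 1) + 2 + e)"
    using assms(4,5) by (intro power_decreasing) auto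
  have "(t ^ Suc J * v) ^ (2 * j) = t ^ e * v ^ (2 * j)"
    unfolding power_mult_distrib power_mult[symmetric] e_def by (simp only: mult_ac)
  moreover have "(t ^ J * w) ^ (2 * (j + 1)) \<ge> 0"
    by (rule zero_le_even_power) simp
  ultimately have "(t ^ J * w) ^ (2 * (j + 1)) + (t ^ Suc J * v) ^ (2 * j) \<ge> t ^ e * v ^ (2 * j)"
    by linarith
  moreover have "t ^ e * v ^ (2 * j) > 0"
    using v assms(4) by simp
  moreover have "\<bar>(t ^ J * w) ^ (2 * j + 1) * (t ^ Suc J * v) ^ (k + 1)\<bar> =
        t ^ (J * (2 * j + 1) + Suc J * (k + 1)) * (\<bar>w\<bar> ^ (2 * j + 1) * \<bar>v\<bar> ^ (k + 1))"
    unfolding power_mult_distrib power_mult[symmetric] power_add[of t] abs_mult power_abs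
    using assms(4) by (simp only: mult_ac abs_of_pos)
  ultimately have "\<bar>(t ^ J * w) ^ (2 * j + 1) * (t ^ Suc J * v) ^ (k + 1) /
      ((t ^ J * w) ^ (2 * (j + 1)) + (t ^ Suc J * v) ^ (2 * j))\<bar>
    \<le> t ^ (J * (2 * j + 1) + Suc J * (k + 1)) * (\<bar>w\<bar> ^ (2 * j + 1) * \<bar>v\<bar> ^ (k + 1)) / (t ^ e * v ^ (2 * j))"
    unfolding abs_divide using assms(4) by (intro frac_le) auto
  also have "\<dots> \<le> t ^ (k * (J + 1) + 2 + e) * (\<bar>w\<bar> ^ (2 * j + 1) * \<bar>v\<bar> ^ (k + 1)) / (t ^ e * v ^ (2 * j))"
    using le v assms(4) by (intro divide_right_mono mult_right_mono) auto
  also have "\<dots> = \<bar>w\<bar> ^ (2 * j + 1) * \<bar>v\<bar> ^ (k + 1) / v ^ (2 * j) * t ^ (k * (J + 1) + 2)"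
    unfolding power_add[of t _ e] using assms(4) by simp
  finally show ?thesis
    unfolding cusp_function_def using assms(1) by (simp add: w_def v_def)
qed

text \<open>Each f in F is handled on a nonempty Zariski open set, and finitely many of these still
  meet. The same point z serves all exponents e.\<close>

lemma obtain_generic_point:
  fixes a :: "real ^ 'n"
  assumes "finite F" "\<And>f. f \<in> F \<Longrightarrow> regulous k f \<and> f a = 0"
  obtains z where "z $ i1 \<noteq> a $ i1" "z $ i2 \<noteq> a $ i2"
    "\<And>f e. f \<in> F \<Longrightarrow> (\<And>i. e i \<ge> 1) \<Longrightarrow> \<exists>C. \<forall>\<^sub>F t in at 0. \<bar>f (curve a e z t)\<bar> \<le> C * \<bar>t\<bar>"
proof -
  define P where "P f z \<longleftrightarrow> (\<forall>e. (\<forall>i. e i \<ge> 1) \<longrightarrow>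
    (\<exists>C. \<forall>\<^sub>F t in at 0. \<bar>f (curve a e z t)\<bar> \<le> C * \<bar>t\<bar>))" for f z
  have "\<forall>f\<in>F. \<exists>U. zariski_open U \<and> U \<noteq> {} \<and> (\<forall>z\<in>U. P f z)"
  proof
    fix f assume f: "f \<in> F"
    obtain p q U where U: "real_polynomial_function p" "real_polynomial_function q"
      "zariski_open U" "U \<noteq> {}" "\<forall>x\<in>U. q x \<noteq> 0 \<and> f x = p x / q x"
      using assms(2)[OF f] unfolding regulous_def rational_function_def by blast
    have cont: "continuous_on UNIV f" and fa: "f a = 0"
      using assms(2)[OF f] class_C_le[of k f 0] by (simp_all add: regulous_def)
    have "P f z" if "z \<in> U" for z
      unfolding P_def
      by (intro allI impI rational_function_curve[OF cont fa U(1-3) that]) (use U(5) in blast)+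
    then show "\<exists>U. zariski_open U \<and> U \<noteq> {} \<and> (\<forall>z\<in>U. P f z)"
      using U(3,4) by blast
  qed
  from bchoice[OF this] obtain U
    where U: "\<forall>f\<in>F. zariski_open (U f) \<and> U f \<noteq> {} \<and> (\<forall>z\<in>U f. P f z)" ..
  define V where "V = {x :: real ^ 'n. x $ i1 \<noteq> a $ i1} \<inter> {x. x $ i2 \<noteq> a $ i2}"
  have V: "zariski_open V" "V \<noteq> {}"
    unfolding V_def by (intro zariski_open_Int zariski_open_component_neq)+
  have "zariski_open (\<Inter>f\<in>F. U f) \<and> (\<Inter>f\<in>F. U f) \<noteq> {}"
    using assms(1) U by (intro finite_zariski_open_Int) auto
  then obtain z where "z \<in> V \<inter> (\<Inter>f\<in>F. U f)"
    using zariski_open_Int(2)[OF V, of "\<Inter>f\<in>F. U f"] by blast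
  then have z: "z \<in> V" "\<And>f. f \<in> F \<Longrightarrow> P f z"
    using U by blast+
  show thesis
  proof (rule that)
    show "z $ i1 \<noteq> a $ i1" "z $ i2 \<noteq> a $ i2"
      using z(1) by (auto simp: V_def)
    show "\<exists>C. \<forall>\<^sub>F t in at 0. \<bar>f (curve a e z t)\<bar> \<le> C * \<bar>t\<bar>"
      if "f \<in> F" "\<And>i. e i \<ge> 1" for f e
      using z(2)[OF that(1)] that(2) by (simp add: P_def)
  qed
qed

section \<open>Orders of vanishing along the cusp curve\<close>

lemma eventually_abs_add_le:
  fixes f g :: "'b \<Rightarrow> real"
  assumes "\<exists>C. \<forall>\<^sub>F t in F. \<bar>f t\<bar> \<le> C * r t" "\<exists>C. \<forall>\<^sub>F t in F. \<bar>g t\<bar> \<le> C * r t"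
  shows "\<exists>C. \<forall>\<^sub>F t in F. \<bar>f t + g t\<bar> \<le> C * r t"
proof -
  obtain C D where CD: "\<forall>\<^sub>F t in F. \<bar>f t\<bar> \<le> C * r t" "\<forall>\<^sub>F t in F. \<bar>g t\<bar> \<le> D * r t"
    using assms by blast
  have "\<forall>\<^sub>F t in F. \<bar>f t + g t\<bar> \<le> (C + D) * r t"
    using CD by eventually_elim (auto simp: algebra_simps)
  then show ?thesis by blast
qed

lemma eventually_abs_sum_le:
  fixes f :: "'c \<Rightarrow> 'b \<Rightarrow> real"
  assumes "\<And>j. j \<in> I \<Longrightarrow> \<exists>C. \<forall>\<^sub>F t in F. \<bar>f j t\<bar> \<le> C * r t"
  shows "\<exists>C. \<forall>\<^sub>F t in F. \<bar>\<Sum>j\<in>I. f j t\<bar> \<le> C * r t"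
  using assms
proof (induction I rule: infinite_finite_induct)
  case (insert j I)
  then show ?case by (simp add: eventually_abs_add_le)
qed (auto intro!: exI[of _ 0])

lemma norm_cusp_curve_le:
  assumes "0 \<le> t" "t \<le> 1"
  shows "norm (cusp_curve a i2 J z t - a) \<le> norm (z - a) * t ^ J"
proof -
  have "norm (cusp_curve a i2 J z t - a) \<le> norm (t ^ J *\<^sub>R (z - a))"
  proof (rule norm_le_componentwise_cart)
    fix i
    have "t ^ Suc J \<le> t ^ J"
      using assms by (intro power_decreasing) auto
    then show "norm ((cusp_curve a i2 J z t - a) $ i) \<le> norm ((t ^ J *\<^sub>R (z - a)) $ i)"
      using assms by (auto simp: abs_mult intro!: mult_right_mono)
  qed
  then show ?thesis
    using assms by (simp add: mult.commute)
qed

text \<open>The Lipschitz bound on the k-th derivative yields |G x| <= C |x - a| |Y|^k near a. On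
  the curve |Y|^k has order at least k(J+1) and |x - a| has order at least J, which supplies the
  extra t^2.\<close>

lemma flat_curve_bound:
  assumes "class_C k G" "lipschitz_at a ((partial i2 ^^ k) G)" "J \<ge> 2"
    and flat: "\<And>m x. m \<le> k \<Longrightarrow> x $ i2 = a $ i2 \<Longrightarrow> (partial i2 ^^ m) G x = 0"
  shows "\<exists>C. \<forall>\<^sub>F t in at_right 0. \<bar>G (cusp_curve a i2 J z t)\<bar> \<le> C * t ^ (k * (J + 1) + 2)"
proof -
  define \<gamma> where "\<gamma> = cusp_curve a i2 J z"
  have "(partial i2 ^^ k) G a = 0"
    using flat by simp
  then obtain C where C: "C \<ge> 0" "\<forall>\<^sub>F x in nhds a. \<bar>(partial i2 ^^ k) G x\<bar> \<le> C * norm (x - a)"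
    using assms(2) unfolding lipschitz_at_def by auto
  then obtain d where d: "d > 0" "\<And>x. norm (x - a) < d \<Longrightarrow> \<bar>(partial i2 ^^ k) G x\<bar> \<le> C * norm (x - a)"
    unfolding eventually_nhds_metric dist_norm by auto
  have bound: "\<bar>G x\<bar> \<le> C * norm (x - a) * \<bar>x $ i2 - a $ i2\<bar> ^ k" if "norm (x - a) < d" for x
  \<comment> \<open>The ball has radius |x - a|, so the constant B = C |x - a| may depend on
    x.\<close>
  proof (rule abs_le_power_component[where r = "norm (x - a)"])
    fix y :: "real ^ 'a"
    assume y: "norm (y - a) \<le> norm (x - a)"
    then have "\<bar>(partial i2 ^^ k) G y\<bar> \<le> C * norm (y - a)"
      using d(2)[of y] that by simp
    also have "\<dots> \<le> C * norm (x - a)"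
      using y C(1) by (intro mult_left_mono)
    finally show "\<bar>(partial i2 ^^ k) G y\<bar> \<le> C * norm (x - a)" .
  qed (use assms C(1) flat in auto)
  have "(\<gamma> \<longlongrightarrow> \<gamma> 0) (at_right 0)"
    using tendsto_within_subset[OF isCont_curve[unfolded isCont_def] subset_UNIV]
    unfolding \<gamma>_def .
  moreover have "\<gamma> 0 = a"
    unfolding \<gamma>_def using assms(3) by (intro curve_0) auto
  ultimately have "\<forall>\<^sub>F t in at_right 0. dist (\<gamma> t) a < d"
    using d(1) by (intro tendstoD) auto
  moreover have "\<forall>\<^sub>F t in at_right 0. t \<in> {0<..<1::real}"
    by (rule eventually_at_right_real) simp
  ultimately have "\<forall>\<^sub>F t in at_right 0. \<bar>G (\<gamma> t)\<bar> \<le>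
      C * norm (z - a) * \<bar>z $ i2 - a $ i2\<bar> ^ k * t ^ (k * (J + 1) + 2)"
  proof eventually_elim
    case (elim t)
    have "norm (\<gamma> t - a) \<le> norm (z - a) * t ^ J"
      unfolding \<gamma>_def using elim by (intro norm_cusp_curve_le) auto
    also have "\<dots> \<le> norm (z - a) * t ^ 2"
      using elim assms(3) by (intro mult_left_mono power_decreasing) auto
    finally have le: "norm (\<gamma> t - a) \<le> norm (z - a) * t ^ 2" .
    have "\<bar>G (\<gamma> t)\<bar> \<le> C * norm (\<gamma> t - a) * \<bar>\<gamma> t $ i2 - a $ i2\<bar> ^ k"
      using elim(1) by (intro bound) (simp add: dist_norm)
    also have "\<dots> \<le> C * (norm (z - a) * t ^ 2) * \<bar>\<gamma> t $ i2 - a $ i2\<bar> ^ k"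
      using le C(1) by (intro mult_right_mono mult_left_mono) auto
    also have "\<bar>\<gamma> t $ i2 - a $ i2\<bar> ^ k = t ^ (k * (J + 1)) * \<bar>z $ i2 - a $ i2\<bar> ^ k"
      using elim by (simp add: \<gamma>_def abs_mult power_mult_distrib power_add mult.commute flip: power_mult)
    finally show ?case
      by (simp add: power_add power2_eq_square mult_ac)
  qed
  then show ?thesis
    unfolding \<gamma>_def by blast
qed

text \<open>For k = 0 no derivative is available, and order 2 comes from order 1 of both factors on
  the curve. For k > 0 the bound comes from \<open>lipschitz_at_partial_mult\<close> and
  \<open>flat_curve_bound\<close>.\<close>

lemma sum_products_curve_bound:
  fixes a :: "real ^ 'n"
  assumes "\<And>b. b \<in> A \<Longrightarrow> class_C k (H b) \<and> class_C k b \<and> H b a = 0 \<and> b a = 0"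
    and "\<And>b. b \<in> A \<Longrightarrow> \<exists>C. \<forall>\<^sub>F t in at 0. \<bar>H b (cusp_curve a i2 J z t)\<bar> \<le> C * \<bar>t\<bar>"
    and "\<And>b. b \<in> A \<Longrightarrow> \<exists>C. \<forall>\<^sub>F t in at 0. \<bar>b (cusp_curve a i2 J z t)\<bar> \<le> C * \<bar>t\<bar>"
    and "J \<ge> 2" "G = (\<lambda>x. \<Sum>b\<in>A. H b x * b x)"
    and flat: "\<And>m x. m \<le> k \<Longrightarrow> x $ i2 = a $ i2 \<Longrightarrow> (partial i2 ^^ m) G x = 0"
  shows "\<exists>C. \<forall>\<^sub>F t in at_right 0. \<bar>G (cusp_curve a i2 J z t)\<bar> \<le> C * t ^ (k * (J + 1) + 2)"
proof (cases k)
  case 0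
  have "\<exists>C. \<forall>\<^sub>F t in at_right 0. \<bar>\<Sum>b\<in>A. H b (cusp_curve a i2 J z t) * b (cusp_curve a i2 J z t)\<bar> \<le> C * t ^ 2"
  proof (rule eventually_abs_sum_le)
    fix b assume "b \<in> A"
    then obtain C D where "\<forall>\<^sub>F t in at 0. \<bar>H b (cusp_curve a i2 J z t)\<bar> \<le> C * \<bar>t\<bar>"
      "\<forall>\<^sub>F t in at 0. \<bar>b (cusp_curve a i2 J z t)\<bar> \<le> D * \<bar>t\<bar>"
      using assms(2,3) by blast
    then have "\<forall>\<^sub>F t in at 0. \<bar>H b (cusp_curve a i2 J z t) * b (cusp_curve a i2 J z t)\<bar> \<le> C * D * t ^ 2"
    proof eventually_elim
      case (elim t)
      have "\<bar>H b (cusp_curve a i2 J z t)\<bar> * \<bar>b (cusp_curve a i2 J z t)\<bar> \<le> (C * \<bar>t\<bar>) * (D * \<bar>t\<bar>)"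
        using elim by (intro mult_mono) auto
      also have "\<dots> = C * D * (\<bar>t\<bar> * \<bar>t\<bar>)"
        by (simp only: mult_ac)
      finally show ?case
        by (simp add: abs_mult power2_eq_square)
    qed
    then show "\<exists>C. \<forall>\<^sub>F t in at_right 0. \<bar>H b (cusp_curve a i2 J z t) * b (cusp_curve a i2 J z t)\<bar> \<le> C * t ^ 2"
      using filter_leD[OF at_le[of "{0<..}" UNIV 0]] by blast
  qed
  moreover have e: "k * (J + 1) + 2 = 2"
    by (simp add: 0)
  ultimately show ?thesis
    unfolding assms(5) e by blast
next
  case (Suc n)
  show ?thesis
  proof (rule flat_curve_bound[OF _ _ assms(4) flat])
    have cl: "class_C k (\<lambda>x. H b x * b x)" if "b \<in> A" for b
      using assms(1)[OF that] by (intro class_C_mult) auto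
    show "class_C k G"
      unfolding assms(5) using cl by (rule class_C_sum)
    have "(partial i2 ^^ k) G = (\<lambda>x. \<Sum>b\<in>A. (partial i2 ^^ k) (\<lambda>x. H b x * b x) x)"
      using funpow_partial_sum[of A k "\<lambda>b x. H b x * b x" i2 "\<lambda>_. 1"] cl by (simp add: assms(5))
    moreover have "lipschitz_at a ((partial i2 ^^ k) (\<lambda>x. H b x * b x))" if "b \<in> A" for b
      using assms(1)[OF that] unfolding Suc by (intro lipschitz_at_partial_mult) auto
    ultimately show "lipschitz_at a ((partial i2 ^^ k) G)"
      by (simp add: lipschitz_at_sum)
  qed auto
qed

section \<open>Comparison of the two orders of a combination of cusp functions\<close>

theorem theorem4p3:
  fixes k :: nat and M :: "(real ^ 'n \<Rightarrow> real) set"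
  assumes "CARD('n) \<ge> 2"
    and "maximalideal M (regulous_ring k)"
  shows "\<not> (\<exists>A \<subseteq> carrier (regulous_ring k). finite A \<and> M = Idl\<^bsub>regulous_ring k\<^esub> A)"
proof
  assume "\<exists>A \<subseteq> carrier (regulous_ring k). finite A \<and> M = Idl\<^bsub>regulous_ring k\<^esub> A"
  then obtain A where A: "A \<subseteq> carrier (regulous_ring k)" "finite A" "M = Idl\<^bsub>regulous_ring k\<^esub> A"
    by blast
  obtain a where M: "M = {f. regulous k f \<and> f a = 0}"
    using maximalideal_finitely_generated[OF assms(2) A] .
  have "A \<subseteq> M"
    using ring.genideal_self[OF cring.axioms(1)[OF cring_regulous_ring] A(1)] A(3) by simp
  then have regA: "regulous k b \<and> b a = 0" if "b \<in> A" for b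
    using that M by blast
  obtain i1 i2 :: 'n where i: "i1 \<noteq> i2"
    using assms(1) card_le_Suc0_iff_eq[of "UNIV :: 'n set"] by auto
  define g where "g = cusp_function k a i1 i2"
  \<comment> \<open>There is one index more than there are generators, so the linear system below
    has a nontrivial solution; the indices start at 2 because \<open>flat_curve_bound\<close> needs
    \<open>J \<ge> 2\<close>.\<close>
  define I where "I = {2..card A + 2}"
  have finI: "finite I"
    by (simp add: I_def)
  have reg: "regulous k (g j)" and flat: "m \<le> k \<Longrightarrow> x $ i2 = a $ i2 \<Longrightarrow> (partial i2 ^^ m) (g j) x = 0"
    if "j \<in> I" for j m x
    using regulous_cusp_function[OF i] funpow_partial_cusp_function[OF i] that
    by (auto simp: g_def I_def)
  have "\<forall>j\<in>I. \<exists>h. (\<forall>b\<in>A. regulous k (h b)) \<and> g j = (\<lambda>x. \<Sum>b\<in>A. h b x * b x)"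
  proof
    fix j assume j: "j \<in> I"
    \<comment> \<open>Flatness with m = 0 at the point a says \<open>g j a = 0\<close>.\<close>
    have "g j \<in> Idl\<^bsub>regulous_ring k\<^esub> A"
      using reg[OF j] flat[OF j, of 0 a] M A(3) by simp
    then show "\<exists>h. (\<forall>b\<in>A. regulous k (h b)) \<and> g j = (\<lambda>x. \<Sum>b\<in>A. h b x * b x)"
      by (rule regulous_genideal[OF A(1,2)])
  qed
  from bchoice[OF this] obtain h
    where "\<forall>j\<in>I. (\<forall>b\<in>A. regulous k (h j b)) \<and> g j = (\<lambda>x. \<Sum>b\<in>A. h j b x * b x)" ..
  then have h: "\<And>j b. j \<in> I \<Longrightarrow> b \<in> A \<Longrightarrow> regulous k (h j b)"
    "\<And>j. j \<in> I \<Longrightarrow> g j = (\<lambda>x. \<Sum>b\<in>A. h j b x * b x)"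
    by simp_all
  \<comment> \<open>One equation per generator b: the combined coefficient of b must vanish at a, so
    that G becomes a sum of products of two elements of M.\<close>
  obtain c where c: "\<exists>j\<in>I. c j \<noteq> 0" "\<And>b. b \<in> A \<Longrightarrow> (\<Sum>j\<in>I. c j * h j b a) = 0"
    using homogeneous_system_solution[OF A(2), of I "\<lambda>j b. h j b a"] by (auto simp: I_def)
  define H where "H b x = (\<Sum>j\<in>I. c j * h j b x)" for b x
  define G where "G x = (\<Sum>j\<in>I. c j * g j x)" for x
  have H: "regulous k (H b) \<and> H b a = 0" if "b \<in> A" for b
    unfolding H_def using h(1) c(2) that by (auto intro!: regulous_sum regulous_mult regulous_const)
  have "(\<Sum>j\<in>I. c j * g j x) = (\<Sum>j\<in>I. \<Sum>b\<in>A. c j * h j b x * b x)" for x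
    by (intro sum.cong) (auto simp: h(2) sum_distrib_left mult.assoc)
  then have GH: "G = (\<lambda>x. \<Sum>b\<in>A. H b x * b x)"
    by (simp add: fun_eq_iff G_def H_def sum_distrib_right sum.swap[of _ A I])
  have flatG: "(partial i2 ^^ m) G x = 0" if m: "m \<le> k" and x: "x $ i2 = a $ i2" for m x
  proof -
    have "class_C m (g j)" if "j \<in> I" for j
      using reg[OF that] m class_C_le by (auto simp: regulous_def)
    then have "(partial i2 ^^ m) G = (\<lambda>x. \<Sum>j\<in>I. c j * (partial i2 ^^ m) (g j) x)"
      unfolding G_def by (rule funpow_partial_sum)
    then show ?thesis
      using flat m x by (simp add: sum.neutral)
  qed
  \<comment> \<open>The largest index occurring in G fixes the weights of the curve; all other terms
    then have higher order on it.\<close>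
  define J where "J = Max {j \<in> I. c j \<noteq> 0}"
  have "J \<in> {j \<in> I. c j \<noteq> 0}"
    unfolding J_def using c(1) by (intro Max_in) (auto simp: I_def)
  then have J: "J \<in> I" "c J \<noteq> 0" "J \<ge> 2" by (auto simp: I_def)
  have J_max: "j \<le> J" if "j \<in> I" "c j \<noteq> 0" for j
    unfolding J_def using that by (intro Max_ge) (auto simp: I_def)
  have "regulous k f \<and> f a = 0" if "f \<in> A \<union> H ` A" for f
    using that regA H by blast
  \<comment> \<open>The point is generic for the generators and for their coefficients
    \<open>H b\<close>, the two factors of each product.\<close>
  then obtain z where z: "z $ i1 \<noteq> a $ i1" "z $ i2 \<noteq> a $ i2"
    "\<And>f e. f \<in> A \<union> H ` A \<Longrightarrow> (\<And>i. e i \<ge> 1) \<Longrightarrow> \<exists>C. \<forall>\<^sub>F t in at 0. \<bar>f (curve a e z t)\<bar> \<le> C * \<bar>t\<bar>"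
    using obtain_generic_point[of "A \<union> H ` A" k a i1 i2] A(2) by blast
  define \<gamma> where "\<gamma> = cusp_curve a i2 J z"
  define E where "E = k * (J + 1) + 1"
  have "\<exists>C. \<forall>\<^sub>F t in at_right 0. \<bar>G (\<gamma> t)\<bar> \<le> C * t ^ Suc E"
  proof -
    have "\<exists>C. \<forall>\<^sub>F t in at_right 0. \<bar>G (\<gamma> t)\<bar> \<le> C * t ^ (k * (J + 1) + 2)"
      unfolding \<gamma>_def
    proof (rule sum_products_curve_bound[OF _ _ _ J(3) GH flatG])
      show "class_C k (H b) \<and> class_C k b \<and> H b a = 0 \<and> b a = 0" if "b \<in> A" for b
        using regA[OF that] H[OF that] by (simp add: regulous_def)
    qed (use z(3) J(3) in auto)
    then show ?thesis by (simp add: E_def)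
  qed
  \<comment> \<open>The remaining terms, with sign reversed so that adding them to G isolates the
    term of index J.\<close>
  moreover have "\<exists>C. \<forall>\<^sub>F t in at_right 0. \<bar>\<Sum>j\<in>I - {J}. - c j * g j (\<gamma> t)\<bar> \<le> C * t ^ Suc E"
  proof (rule eventually_abs_sum_le)
    fix j assume j: "j \<in> I - {J}"
    show "\<exists>C. \<forall>\<^sub>F t in at_right 0. \<bar>- c j * g j (\<gamma> t)\<bar> \<le> C * t ^ Suc E"
    proof (cases "c j = 0")
      case True
      then show ?thesis by (intro exI[of _ 0]) simp
    next
      case False
      then have "j < J"
        using j J_max[of j] by auto
      define C where "C = \<bar>z $ i1 - a $ i1\<bar> ^ (2 * j + 1) * \<bar>z $ i2 - a $ i2\<bar> ^ (k + 1) / (z $ i2 - a $ i2) ^ (2 * j)"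
      have "\<forall>\<^sub>F t in at_right 0. t \<in> {0<..<1::real}"
        by (rule eventually_at_right_real) simp
      then have "\<forall>\<^sub>F t in at_right 0. \<bar>- c j * g j (\<gamma> t)\<bar> \<le> (\<bar>c j\<bar> * C) * t ^ Suc E"
      proof eventually_elim
        case (elim t)
        then have "\<bar>g j (\<gamma> t)\<bar> \<le> C * t ^ Suc E"
          using cusp_function_curve_le[OF i z(2) \<open>j < J\<close>, of t k] by (simp add: g_def \<gamma>_def C_def E_def)
        from mult_left_mono[OF this, of "\<bar>c j\<bar>"] show ?case
          by (simp add: abs_mult mult_ac)
      qed
      then show ?thesis by blast
    qed
  qed
  ultimately have "\<exists>C. \<forall>\<^sub>F t in at_right 0.
      \<bar>G (\<gamma> t) + (\<Sum>j\<in>I - {J}. - c j * g j (\<gamma> t))\<bar> \<le> C * t ^ Suc E"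
    by (rule eventually_abs_add_le)
  then obtain C where
    C: "\<forall>\<^sub>F t in at_right 0. \<bar>G (\<gamma> t) + (\<Sum>j\<in>I - {J}. - c j * g j (\<gamma> t))\<bar> \<le> C * t ^ Suc E" ..
  \<comment> \<open>The coefficient of t^E in the term of index J.\<close>
  define K where "K = c J * g J z"
  have "K \<noteq> 0"
  proof -
    have "(z $ i1 - a $ i1) ^ (2 * (J + 1)) + (z $ i2 - a $ i2) ^ (2 * J) > 0"
      using z(1,2) unfolding power_mult by (intro add_pos_pos) auto
    then show ?thesis
      using J(2) z(1,2) by (simp add: K_def g_def cusp_function_def)
  qed
  \<comment> \<open>Dividing by t^E leaves the constant |K| bounded by C t, which forces K = 0 in
    the limit.\<close>
  have "\<forall>\<^sub>F t in at_right 0. \<bar>K\<bar> \<le> C * t"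
    using C eventually_at_right_less
  proof eventually_elim
    case (elim t)
    have "G (\<gamma> t) = c J * g J (\<gamma> t) + (\<Sum>j\<in>I - {J}. c j * g j (\<gamma> t))"
      unfolding G_def using finI J(1) by (rule sum.remove)
    then have "G (\<gamma> t) + (\<Sum>j\<in>I - {J}. - c j * g j (\<gamma> t)) = c J * g J (\<gamma> t)"
      by (simp add: sum_negf)
    also have "\<dots> = K * t ^ E"
      using cusp_function_curve_eq[OF i z(1,2), of t k J] elim by (simp add: g_def \<gamma>_def K_def E_def)
    finally have "\<bar>K\<bar> * t ^ E \<le> (C * t) * t ^ E"
      using elim by (simp add: abs_mult mult_ac)
    then show ?case
      using elim by simp
  qed
  moreover have "((\<lambda>t. C * t) \<longlongrightarrow> C * 0) (at_right 0)"
    by (intro tendsto_intros)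
  ultimately have "\<bar>K\<bar> \<le> C * 0"
    using tendsto_lowerbound[of "\<lambda>t. C * t"] trivial_limit_at_right_real by blast
  then show False
    using \<open>K \<noteq> 0\<close> by simp
qed

end
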